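(* Let $n\geq 1$ and $k\geq 2$ be integers, and let $r$ be an integer with $1\le r\le$ the number of length-$n$ unbordered words over $\Sigma_k$. The unbordered word $w\in\Sigma_k^n$ with rank $r$ (i.e., the $r$-th word in the lexicographic listing of all length-$n$ unbordered words over $\Sigma_k$) can be computed from $r,n,k$ in $O(n^4k\log k)$ time using $O(n)$ space, under the unit-cost RAM model.
   Context: $\Sigma_k=\{1,2,\ldots,k\}$ with $1<2<\cdots<k$, and $\Sigma_k^n$ is the set of length-$n$ words over $\Sigma_k$. Lexicographic order: for $x=x_1\cdots x_m$ and $y=y_1\cdots y_n$, $x<y$ if $x$ is a proper prefix of $y$, or if $x_i<y_i$ for the smallest $i$ with $x_i\neq y_i$. A border of a word $w$ is a word that is both a non-empty proper prefix and a non-empty proper suffix of $w$; $w$ is unbordered if it has no border. Ranks start at $1$. Unit-cost RAM model: integer variables use constant space and integer arithmetic operations take constant time. *)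

theory Defs
  imports Complex_Main
begin

definition is_word :: "nat \<Rightarrow> nat \<Rightarrow> nat list \<Rightarrow> bool" where
  "is_word k n w \<longleftrightarrow> length w = n \<and> set w \<subseteq> {1..k}"

definition has_border :: "'a list \<Rightarrow> bool" where
  "has_border w \<longleftrightarrow> (\<exists>u. u \<noteq> [] \<and> length u < length w \<and>
       (\<exists>v. w = u @ v) \<and> (\<exists>v. w = v @ u))"

definition unbordered :: "'a list \<Rightarrow> bool" where
  "unbordered w \<longleftrightarrow> \<not> has_border w"

definition unb_words :: "nat \<Rightarrow> nat \<Rightarrow> nat list set" where
  "unb_words n k = {w. is_word k n w \<and> unbordered w}"

definition lex_less :: "nat list \<Rightarrow> nat list \<Rightarrow> bool" where
  "lex_less x y \<longleftrightarrow> (\<exists>u. u \<noteq> [] \<and> y = x @ u) \<or>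
     (\<exists>i. i < length x \<and> i < length y \<and> take i x = take i y \<and> x ! i < y ! i)"

text \<open>The unbordered word of rank r (ranks start at 1).\<close>
definition has_rank :: "nat \<Rightarrow> nat \<Rightarrow> nat \<Rightarrow> nat list \<Rightarrow> bool" where
  "has_rank n k r w \<longleftrightarrow> w \<in> unb_words n k \<and>
     card {v \<in> unb_words n k. lex_less v w} = r - 1"

text \<open>Registers indexed by nat, holding unbounded integers. Every instruction costs one
  time unit. Space = number of distinct registers ever accessed.\<close>

datatype instr =
    Const nat int
  | Add nat nat nat
  | Sub nat nat nat
  | Mul nat nat nat
  | Div nat nat nat          (* floor division, x div 0 = 0 *)
  | Mod nat nat nat
  | Less nat nat nat
  | Load nat nat
  | Store nat nat
  | Jz nat nat
  | Jmp nat
  | Halt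

type_synonym ram_state = "nat \<times> (nat \<Rightarrow> int) \<times> nat set"
  (* program counter, memory, set of accessed registers *)

fun bin :: "(int \<Rightarrow> int \<Rightarrow> int) \<Rightarrow> nat \<Rightarrow> nat \<Rightarrow> nat \<Rightarrow> ram_state \<Rightarrow> ram_state" where
  "bin f i j l (pc, m, A) = (Suc pc, m(i := f (m j) (m l)), A \<union> {i, j, l})"

fun step :: "instr list \<Rightarrow> ram_state \<Rightarrow> ram_state option" where
  "step P (pc, m, A) =
    (if length P \<le> pc then None else
     (case P ! pc of
        Const i c \<Rightarrow> Some (Suc pc, m(i := c), A \<union> {i})
      | Add i j l \<Rightarrow> Some (bin (+) i j l (pc, m, A))
      | Sub i j l \<Rightarrow> Some (bin (-) i j l (pc, m, A))
      | Mul i j l \<Rightarrow> Some (bin (*) i j l (pc, m, A))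
      | Div i j l \<Rightarrow> Some (bin (div) i j l (pc, m, A))
      | Mod i j l \<Rightarrow> Some (bin (mod) i j l (pc, m, A))
      | Less i j l \<Rightarrow> Some (bin (\<lambda>x y. if x < y then 1 else 0) i j l (pc, m, A))
      | Load i j \<Rightarrow> Some (Suc pc, m(i := m (nat (m j))), A \<union> {i, j, nat (m j)})
      | Store i j \<Rightarrow> Some (Suc pc, m(nat (m i) := m j), A \<union> {i, j, nat (m i)})
      | Jz i t \<Rightarrow> Some (if m i = 0 then t else Suc pc, m, A \<union> {i})
      | Jmp t \<Rightarrow> Some (t, m, A)
      | Halt \<Rightarrow> None))"

inductive runs :: "instr list \<Rightarrow> ram_state \<Rightarrow> nat \<Rightarrow> ram_state \<Rightarrow> bool" where
  halt_run: "step P s = None \<Longrightarrow> runs P s 0 s"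
| step_run: "step P s = Some s' \<Longrightarrow> runs P s' t s'' \<Longrightarrow> runs P s (Suc t) s''"

definition init_state :: "nat \<Rightarrow> nat \<Rightarrow> nat \<Rightarrow> ram_state" where
  "init_state r n k = (0, (\<lambda>_. 0)(0 := int r, 1 := int n, 2 := int k), {0, 1, 2})"

definition output_word :: "nat \<Rightarrow> ram_state \<Rightarrow> int list" where
  "output_word n s = map (fst (snd s)) [0..<n]"

definition space_used :: "ram_state \<Rightarrow> nat" where
  "space_used s = card (snd (snd s))"

end

theory Submission
  imports Defs
begin

text \<open>
  The shortest border of a bordered word of length \<open>N\<close> is unbordered and has length at most
  \<open>N / 2\<close>. Sorting the length-\<open>N\<close> words that are compatible with a fixed prefix \<open>p\<close> by their
  shortest border \<open>u\<close> therefore expresses the number of unbordered ones through the numbers for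
  lengths \<open>b \<le> N / 2\<close>: each \<open>u\<close> extends to \<open>u y u\<close> in a number of ways that depends only on
  \<open>p\<close>, \<open>N\<close> and \<open>b\<close>. This gives the number of unbordered words with prefix \<open>p\<close> in \<open>O(n\<^sup>2)\<close>
  operations, because a word is packed into one integer in base \<open>k\<close>, so that prefixes, suffixes
  and their comparison cost one division each. The word of rank \<open>r\<close> is found letter by letter:
  either the current prefix contains the wanted word and is extended by the smallest letter,
  or its count is subtracted from the rank and its last letter is increased. This takes
  \<open>O(n k)\<close> rounds, hence \<open>O(n\<^sup>3 k)\<close> steps in total.
\<close>

section \<open>Counting unbordered words by their shortest border\<close>

text \<open>The counts in the recursion depend on the prefix, so their table is rebuilt for every
  prefix tried; it needs \<open>n\<close> registers, next to \<open>n + 1\<close> for the powers of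
  \<open>k\<close>. Two features of the machine shape the second half. Its code is flat with
  absolute jumps, and the accessed registers are part of its state. Hence a small structured
  language is compiled to it, with a correctness judgement that bounds time and touched registers
  together; linear space then means that every address stays below \<open>2 * n + 60\<close>. Its
  integers are unbounded at unit cost, which makes it legitimate to pack a word into one register.
  The search never goes back: the ranks of the words below the parent prefix are known to include
  the wanted one, so increasing the last letter cannot run past \<open>k\<close>. This bounds the
  number of rounds.\<close>

definition border_len :: "'a list \<Rightarrow> nat \<Rightarrow> bool" where
  "border_len w b \<longleftrightarrow> 1 \<le> b \<and> b < length w \<and> take b w = drop (length w - b) w"

lemma has_border_iff: "has_border w \<longleftrightarrow> (\<exists>b. border_len w b)"
proof
  assume "has_border w"
  then obtain u v v' where *: "u \<noteq> []" "length u < length w" "w = u @ v" "w = v' @ u"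
    unfolding has_border_def by blast
  have "take (length u) w = u" using *(3) by simp
  moreover have "drop (length w - length u) w = u" using *(4) by simp
  ultimately have "border_len w (length u)"
    using *(1,2) by (simp add: border_len_def Suc_le_eq)
  then show "\<exists>b. border_len w b" ..
next
  assume "\<exists>b. border_len w b"
  then obtain b where b: "1 \<le> b" "b < length w" "take b w = drop (length w - b) w"
    unfolding border_len_def by blast
  have "take b w \<noteq> []" "length (take b w) < length w" using b(1,2) by auto
  moreover have "w = take b w @ drop b w" by simp
  moreover have "w = take (length w - b) w @ take b w" unfolding b(3) by simp
  ultimately show "has_border w" unfolding has_border_def by metis
qed

text \<open>The last \<open>c\<close> letters of \<open>w\<close> lie inside the final copy of
  \<open>take b w\<close>, so bordering is transitive. This makes a shortest border
  unbordered.\<close>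

lemma border_len_take:
  assumes "border_len w b" "border_len (take b w) c"
  shows "border_len w c"
proof -
  have b: "b < length w" "take b w = drop (length w - b) w"
    using assms(1) by (auto simp: border_len_def)
  have c: "1 \<le> c" "c < b" "take c (take b w) = drop (b - c) (take b w)"
    using assms(2) b(1) by (auto simp: border_len_def)
  have "take c (take b w) = take c w" using c(2) by (simp add: min_def)
  moreover have "drop (b - c) (take b w) = drop (length w - c) w"
    using b c(2) by simp
  ultimately show ?thesis unfolding border_len_def using b(1) c by simp
qed

text \<open>The initial and the final copy of the border overlap in \<open>2 * b - length w\<close>
  letters. The overlap ends the one copy and begins the other; as the copies are equal, it is itself
  a border. Hence a shortest border fills at most half of the word.\<close>

lemma border_len_shorten:
  assumes "border_len w b" "length w < 2 * b"
  shows "border_len w (2 * b - length w)"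
proof -
  define c where "c = 2 * b - length w"
  have b: "b < length w" "take b w = drop (length w - b) w"
    using assms(1) by (auto simp: border_len_def)
  have e: "length w - b = b - c" "length w - c = (b - c) + (length w - b)" "c < b" "1 \<le> c"
    using b(1) assms(2) by (auto simp: c_def)
  have "drop (length w - c) w = drop (b - c) (take b w)"
    using b(2) e(2) by simp
  also have "\<dots> = take c (drop (length w - b) w)"
    using e by (simp add: drop_take)
  also have "\<dots> = take c w" unfolding b(2)[symmetric] using e(3) by (simp add: min_def)
  finally have "border_len w c" using e(3,4) b(1) by (simp add: border_len_def)
  then show ?thesis by (simp add: c_def)
qed

text \<open>The last \<open>b\<close> letters of \<open>w\<close> also end the final copy of the
  longer border, which equals the initial copy. So a word has at most one unbordered border, and
  sorting bordered words by it counts none twice.\<close>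

lemma border_len_nested:
  assumes "border_len w b" "border_len w c" "b < c"
  shows "border_len (take c w) b"
proof -
  have b: "1 \<le> b" "take b w = drop (length w - b) w" 
    and c: "c < length w" "take c w = drop (length w - c) w"
    using assms by (auto simp: border_len_def)
  have "drop (c - b) (take c w) = drop (length w - b) w"
    using c assms(3) by simp
  moreover have "take b (take c w) = take b w" using assms(3) by (simp add: min_def)
  ultimately show ?thesis unfolding border_len_def using b c(1) assms(3) by simp
qed

text \<open>The least border length is the witness: an overlap of the two copies, or a border of the
  border, would give a smaller one.\<close>

lemma has_border_iff_short:
  "has_border w \<longleftrightarrow> (\<exists>b\<in>{1..length w div 2}. border_len w b \<and> unbordered (take b w))"
proof
  assume "has_border w"
  then have ex: "\<exists>b. border_len w b" by (simp add: has_border_iff)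
  define b where "b = (LEAST b. border_len w b)"
  have b: "border_len w b" using ex unfolding b_def by (rule LeastI_ex)
  have least: "\<not> border_len w c" if "c < b" for c
    using that unfolding b_def by (rule not_less_Least)
  have "2 * b \<le> length w"
  proof (rule ccontr)
    assume "\<not> 2 * b \<le> length w"
    then have "border_len w (2 * b - length w)" by (intro border_len_shorten b) simp
    moreover have "2 * b - length w < b" using b by (auto simp: border_len_def)
    ultimately show False using least by blast
  qed
  moreover have "unbordered (take b w)"
  proof -
    have "\<not> border_len (take b w) c" for c
    proof
      assume c: "border_len (take b w) c"
      then have "c < b" by (simp add: border_len_def)
      then show False using border_len_take[OF b c] least by blast
    qed
    then show ?thesis by (simp add: unbordered_def has_border_iff)
  qed
  moreover have "1 \<le> b" using b by (simp add: border_len_def)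
  ultimately show "\<exists>b\<in>{1..length w div 2}. border_len w b \<and> unbordered (take b w)"
    using b by auto
qed (auto simp: has_border_iff)

section \<open>Numbers of words with a prescribed prefix\<close>

lemma finite_words: "finite {w. is_word k n w}"
proof -
  have "{w. is_word k n w} = {w. set w \<subseteq> {1..k} \<and> length w = n}" by (auto simp: is_word_def)
  then show ?thesis by (simp add: finite_lists_length_eq)
qed

lemma card_words: "card {w. is_word k n w} = k ^ n"
proof -
  have "{w. is_word k n w} = {w. set w \<subseteq> {1..k} \<and> length w = n}" by (auto simp: is_word_def)
  then show ?thesis by (simp add: card_lists_length_eq)
qed

lemma is_word_append: "is_word k i u \<Longrightarrow> is_word k j v \<Longrightarrow> is_word k (i + j) (u @ v)"
  by (simp add: is_word_def)

lemma is_word_take: "is_word k n w \<Longrightarrow> is_word k (min i n) (take i w)"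
  by (auto simp: is_word_def dest: in_set_takeD)

lemma is_word_drop: "is_word k n w \<Longrightarrow> is_word k (n - i) (drop i w)"
  by (auto simp: is_word_def dest: in_set_dropD)

text \<open>Appending free letters to \<open>q\<close> enumerates the words. For
  \<open>j > l\<close> the word is \<open>q\<close> itself, and truncated subtraction gives the
  correct \<open>k ^ 0\<close>.\<close>

lemma card_words_prefix:
  assumes "is_word k (min j l) q"
  shows "card {y. is_word k l y \<and> take j y = q} = k ^ (l - j)"
proof -
  have "bij_betw (\<lambda>z. q @ z) {z. is_word k (l - j) z} {y. is_word k l y \<and> take j y = q}"
  proof (rule bij_betw_byWitness[where f' = "drop j"], goal_cases)
    case 1 show ?case using assms by (cases "j \<le> l") (auto simp: is_word_def min_def)
  next
    case 2 show ?case by auto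
  next
    case 3 show ?case
    proof (rule image_subsetI)
      fix z assume "z \<in> {z. is_word k (l - j) z}"
      then have z: "is_word k (l - j) z" by simp
      have e: "min j l + (l - j) = l" by (simp add: min_def)
      have "is_word k l (q @ z)" using is_word_append[OF assms z] by (simp only: e)
      moreover have "take j (q @ z) = q"
        using assms z by (cases "j \<le> l") (auto simp: is_word_def min_def)
      ultimately show "q @ z \<in> {y. is_word k l y \<and> take j y = q}" by simp
    qed
  next
    case 4 show ?case by (auto intro: is_word_drop)
  qed
  from bij_betw_same_card[OF this] show ?thesis by (simp only: card_words)
qed

text \<open>\<open>take N p\<close> also covers lengths \<open>N < |p|\<close>, where the only compatible word is a prefix of \<open>p\<close>;
  this lets the recursion treat all border lengths uniformly.\<close>
definition compatible_words :: "nat \<Rightarrow> nat list \<Rightarrow> nat \<Rightarrow> nat list set" where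
  "compatible_words k p N = {w. is_word k N w \<and> take (length p) w = take N p}"

definition ucount :: "nat \<Rightarrow> nat list \<Rightarrow> nat \<Rightarrow> nat" where
  "ucount k p N = card {w \<in> compatible_words k p N. unbordered w}"

text \<open>The number of \<open>w\<close> of length \<open>N\<close> compatible with \<open>p\<close> that begin and end with a given
  compatible word of length \<open>b \<le> N / 2\<close>. If \<open>p\<close> overlaps the final block, then \<open>w\<close> is determined,
  and it exists iff \<open>p\<close> agrees with its own shift by \<open>N - b\<close>.\<close>
definition ext_count :: "nat \<Rightarrow> nat list \<Rightarrow> nat \<Rightarrow> nat \<Rightarrow> nat" where
  "ext_count k p N b =
    (if length p \<le> N - b then k ^ (N - b - max (length p) b)
     else if drop (N - b) (take N p) = take (min (length p) N - (N - b)) p then 1 else 0)"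

lemma finite_compatible_words: "finite (compatible_words k p N)"
  by (rule finite_subset[OF _ finite_words]) (auto simp: compatible_words_def)

lemma card_compatible_words:
  assumes "is_word k (length p) p"
  shows "card (compatible_words k p N) = k ^ (N - length p)"
  unfolding compatible_words_def
  using is_word_take[OF assms, of N] by (intro card_words_prefix) (simp add: min.commute)

text \<open>The point is that the size does not depend on \<open>u\<close>; this turns the sum over
  all unbordered \<open>u\<close> into a product.\<close>

lemma card_fibre:
  assumes p: "is_word k (length p) p" and b: "2 * b \<le> N" "1 \<le> b"
    and u: "u \<in> compatible_words k p b"
  shows "card {w \<in> compatible_words k p N. take b w = u \<and> drop (N - b) w = u} = ext_count k p N b"
proof -
  have lu: "length u = b" and wu: "is_word k b u" and cu: "take (length p) u = take b p"
    using u by (auto simp: compatible_words_def is_word_def)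
  show ?thesis
  proof (cases "length p \<le> N - b")
    case True
    \<comment> \<open>\<open>Y\<close> holds the possible middle blocks of \<open>u @ y @ u\<close>:
      what \<open>p\<close> prescribes beyond the initial block must begin \<open>y\<close>. If
      \<open>length p <= b\<close>, nothing is prescribed.\<close>
    define Y where "Y = {y. is_word k (N - 2*b) y \<and> take (length p - b) y = drop b p}"
    have len: "length p - b \<le> N - 2 * b" using True b by simp
    have "bij_betw (\<lambda>y. u @ y @ u) Y {w \<in> compatible_words k p N. take b w = u \<and> drop (N - b) w = u}"
    proof (rule bij_betw_byWitness[where f' = "\<lambda>w. drop b (take (N - b) w)"], goal_cases)
      case 1
      show ?case using lu b by (auto simp: Y_def is_word_def)
    next
      case 2
      show ?case
      proof
        fix w assume "w \<in> {w \<in> compatible_words k p N. take b w = u \<and> drop (N - b) w = u}"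
        then have w: "take b w = u" "drop (N - b) w = u" by auto
        have "u @ drop b (take (N - b) w) = take (N - b) w"
          using w(1) b(1) append_take_drop_id[of b "take (N - b) w"] by (simp add: min_absorb1)
        then show "u @ drop b (take (N - b) w) @ u = w"
          using w(2) by (metis append.assoc append_take_drop_id)
      qed
    next
      case 3
      show ?case
      proof (rule image_subsetI)
        fix y assume "y \<in> Y"
        then have y: "is_word k (N - 2*b) y" "take (length p - b) y = drop b p" "length y = N - 2 * b"
          by (auto simp: Y_def is_word_def)
        have "is_word k N (u @ y @ u)" 
          using is_word_append[OF wu is_word_append[OF y(1) wu]] b by (simp add: mult_2)
        moreover have "take (length p) (u @ y @ u) = take N p"
        proof -
          have "take (length p) (u @ y @ u) = take (length p) u @ take (length p - b) y"
            using lu y(3) len by simp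
          also have "\<dots> = p" using cu y(2) by simp
          finally show ?thesis using True by simp
        qed
        moreover have "drop (N - b) (u @ y @ u) = u" using lu y(3) b by simp
        ultimately show "u @ y @ u \<in> {w \<in> compatible_words k p N. take b w = u \<and> drop (N - b) w = u}"
          using lu by (simp add: compatible_words_def)
      qed
    next
      case 4
      show ?case
      proof (rule image_subsetI)
        fix w assume "w \<in> {w \<in> compatible_words k p N. take b w = u \<and> drop (N - b) w = u}"
        then have w: "is_word k N w" "take (length p) w = p" "length w = N"
          using True by (auto simp: compatible_words_def is_word_def)
        have "is_word k (N - 2*b) (drop b (take (N - b) w))"
          using is_word_drop[OF is_word_take[OF w(1), of "N - b"], of b] by (simp add: mult_2)
        moreover have "take (length p - b) (drop b (take (N - b) w)) = drop b p"
        proof -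
          have "take (length p - b) (drop b (take (N - b) w)) = drop b (take (length p) (take (N - b) w))"
            by (simp only: drop_take)
          also have "\<dots> = drop b p" using True w(2) by (simp only: take_take min_absorb1)
          finally show ?thesis .
        qed
        ultimately show "drop b (take (N - b) w) \<in> Y" by (simp add: Y_def)
      qed
    qed
    then have "card {w \<in> compatible_words k p N. take b w = u \<and> drop (N - b) w = u} = card Y"
      by (rule bij_betw_same_card[symmetric])
    also have "\<dots> = k ^ (N - 2*b - (length p - b))"
      unfolding Y_def using is_word_drop[OF p, of b] len
      by (intro card_words_prefix) (simp add: min_def)
    also have "N - 2*b - (length p - b) = N - b - max (length p) b"
      using b by (auto simp: max_def)
    finally show ?thesis using True by (simp add: ext_count_def)
  next
    case False
    \<comment> \<open>Since \<open>b <= N - b < length p\<close>, the prefix covers the whole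
      initial block. It thereby fixes the final block too, so that \<open>c\<close> below is the
      only candidate.\<close>
    have cu': "u = take b p" using cu lu False b by simp
    define c where "c = take (N - b) p @ u"
    have lc: "length c = N" using False b lu by (simp add: c_def)
    have uniq: "w = c" if "w \<in> compatible_words k p N" "drop (N - b) w = u" for w
    proof -
      have "take (N - b) w = take (N - b) (take (length p) w)" using False by (simp add: min_def)
      also have "\<dots> = take (N - b) p" using that(1) by (simp add: compatible_words_def min_def)
      finally show ?thesis using that(2) c_def by (metis append_take_drop_id)
    qed
    have tc: "take b c = u"
    proof -
      have "take b c = take b p" using False b lc unfolding c_def by simp
      then show ?thesis using cu' by simp
    qed
    have dc: "drop (N - b) c = u" using False by (simp add: c_def)
    have wc: "is_word k N c" unfolding c_def
      using is_word_append[OF is_word_take[OF p, of "N - b"] wu] False b by (simp add: min_absorb1)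
    have "take (length p) c = take N p \<longleftrightarrow>
       take (length p - (N - b)) u = drop (N - b) (take N p)"
    proof -
      have "take N p = take (N - b) p @ drop (N - b) (take N p)"
        using append_take_drop_id[of "N - b" "take N p"] by (simp add: min_def)
      moreover have "take (length p) c = take (N - b) p @ take (length p - (N - b)) u"
        using False unfolding c_def by simp
      ultimately show ?thesis by (metis same_append_eq)
    qed
    also have "take (length p - (N - b)) u = take (min (length p) N - (N - b)) p"
    proof -
      have "min (length p - (N - b)) b = min (length p) N - (N - b)" using b by linarith
      then show ?thesis by (simp add: cu')
    qed
    finally have iff: "c \<in> compatible_words k p N \<longleftrightarrow>
       drop (N - b) (take N p) = take (min (length p) N - (N - b)) p"
      using wc by (auto simp: compatible_words_def)
    have "{w \<in> compatible_words k p N. take b w = u \<and> drop (N - b) w = u} =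
       (if c \<in> compatible_words k p N then {c} else {})"
    proof (intro set_eqI iffI)
      fix w assume "w \<in> {w \<in> compatible_words k p N. take b w = u \<and> drop (N - b) w = u}"
      then have "w \<in> compatible_words k p N" "w = c" using uniq[of w] by simp_all
      then show "w \<in> (if c \<in> compatible_words k p N then {c} else {})" by simp
    next
      fix w assume "w \<in> (if c \<in> compatible_words k p N then {c} else {})"
      then have "w = c" "c \<in> compatible_words k p N" by (simp_all split: if_splits)
      then show "w \<in> {w \<in> compatible_words k p N. take b w = u \<and> drop (N - b) w = u}"
        using tc dc by simp
    qed
    then show ?thesis using False iff by (simp add: ext_count_def)
  qed
qed

text \<open>Compatibility with \<open>p\<close> passes to the initial block, so the words split by
  that block into fibres of equal size.\<close>

lemma card_short_border:
  assumes p: "is_word k (length p) p" and b: "2 * b \<le> N" "1 \<le> b"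
  shows "card {w \<in> compatible_words k p N. border_len w b \<and> unbordered (take b w)} =
           ucount k p b * ext_count k p N b"
proof -
  let ?F = "\<lambda>u. {w \<in> compatible_words k p N. take b w = u \<and> drop (N - b) w = u}"
  let ?U = "{w \<in> compatible_words k p b. unbordered w}"
  have tk: "take b w \<in> compatible_words k p b" if "w \<in> compatible_words k p N" for w
  proof -
    have "take (length p) (take b w) = take b (take (length p) w)" by (simp add: min.commute)
    also have "\<dots> = take b p" using that b by (simp add: compatible_words_def min_def)
    finally show ?thesis using that b is_word_take[of k N w b]
      by (simp add: compatible_words_def min_def)
  qed
  have "{w \<in> compatible_words k p N. border_len w b \<and> unbordered (take b w)} = (\<Union>u\<in>?U. ?F u)"
  proof (intro set_eqI iffI)
    fix w assume w: "w \<in> {w \<in> compatible_words k p N. border_len w b \<and> unbordered (take b w)}"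
    then have "length w = N" by (simp add: compatible_words_def is_word_def)
    then have "w \<in> ?F (take b w)" using w by (simp add: border_len_def)
    moreover have "take b w \<in> ?U" using w tk by simp
    ultimately show "w \<in> (\<Union>u\<in>?U. ?F u)" by blast
  next
    fix w assume "w \<in> (\<Union>u\<in>?U. ?F u)"
    then have w: "w \<in> compatible_words k p N" "take b w = drop (N - b) w" "unbordered (take b w)"
      by auto
    then have "length w = N" by (simp add: compatible_words_def is_word_def)
    then show "w \<in> {w \<in> compatible_words k p N. border_len w b \<and> unbordered (take b w)}"
      using w b by (simp add: border_len_def)
  qed
  also have "card \<dots> = (\<Sum>u\<in>?U. card (?F u))"
    by (rule card_UN_disjoint) (auto simp: finite_compatible_words)
  also have "\<dots> = (\<Sum>u\<in>?U. ext_count k p N b)"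
    by (rule sum.cong) (auto intro!: card_fibre[OF p b])
  finally show ?thesis by (simp add: ucount_def)
qed

text \<open>Each bordered word is removed once, at its only unbordered border. The equation is over
  \<open>int\<close> because the program reaches the count by repeated subtraction, without
  truncation.\<close>

lemma ucount_rec:
  assumes p: "is_word k (length p) p"
  shows "int (ucount k p N) = int (k ^ (N - length p)) -
     (\<Sum>b = 1..N div 2. int (ucount k p b) * int (ext_count k p N b))"
proof -
  let ?D = "\<lambda>b. {w \<in> compatible_words k p N. border_len w b \<and> unbordered (take b w)}"
  have disj: "?D b \<inter> ?D c = {}" if "b < c" for b c
    using border_len_nested[OF _ _ that] by (auto simp: unbordered_def has_border_iff)
  have "{w \<in> compatible_words k p N. has_border w} = (\<Union>b\<in>{1..N div 2}. ?D b)"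
    by (auto simp: has_border_iff_short compatible_words_def is_word_def)
  also have "card \<dots> = (\<Sum>b = 1..N div 2. card (?D b))"
  proof (rule card_UN_disjoint)
    show "\<forall>b\<in>{1..N div 2}. \<forall>c\<in>{1..N div 2}. b \<noteq> c \<longrightarrow> ?D b \<inter> ?D c = {}"
    proof (intro ballI impI)
      fix b c :: nat assume "b \<noteq> c"
      then have "b < c \<or> c < b" by linarith
      then show "?D b \<inter> ?D c = {}" using disj[of b c] disj[of c b] by (auto simp del: Int_iff)
    qed
  qed (auto simp: finite_compatible_words)
  also have "\<dots> = (\<Sum>b = 1..N div 2. ucount k p b * ext_count k p N b)"
    by (rule sum.cong) (auto intro!: card_short_border[OF p])
  finally have B: "card {w \<in> compatible_words k p N. has_border w} = \<dots>" .
  have "compatible_words k p N = {w \<in> compatible_words k p N. unbordered w} \<union> {w \<in> compatible_words k p N. has_border w}"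
    by (auto simp: unbordered_def)
  moreover have "card ({w \<in> compatible_words k p N. unbordered w} \<union> {w \<in> compatible_words k p N. has_border w}) =
    ucount k p N + card {w \<in> compatible_words k p N. has_border w}"
    unfolding ucount_def by (rule card_Un_disjoint) (auto simp: finite_compatible_words unbordered_def)
  ultimately have "k ^ (N - length p) = ucount k p N + (\<Sum>b = 1..N div 2. ucount k p b * ext_count k p N b)"
    using card_compatible_words[OF p, of N] B by simp
  then have "int (k ^ (N - length p)) =
      int (ucount k p N + (\<Sum>b = 1..N div 2. ucount k p b * ext_count k p N b))" by (rule arg_cong)
  then show ?thesis by simp
qed

section \<open>Words as numbers\<close>

text \<open>Letters run from 1 to \<open>k\<close>, hence the digits \<open>x - 1\<close>. Leading
  letters 1 become leading zeros, so the number determines the word only together with its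
  length.\<close>

definition word_val :: "nat \<Rightarrow> nat list \<Rightarrow> nat" where
  "word_val k w = foldl (\<lambda>a x. a * k + (x - 1)) 0 w"

lemma word_val_Nil [simp]: "word_val k [] = 0"
  by (simp add: word_val_def)

lemma word_val_snoc [simp]: "word_val k (w @ [x]) = word_val k w * k + (x - 1)"
  by (simp add: word_val_def)

lemma word_val_append: "word_val k (u @ v) = word_val k u * k ^ length v + word_val k v"
proof (induction v rule: rev_induct)
  case (snoc x v)
  have "word_val k (u @ v @ [x]) = word_val k (u @ v) * k + (x - 1)"
    by (simp flip: append_assoc)
  then show ?case using snoc by (simp add: algebra_simps)
qed simp

lemma is_word_snoc: "is_word k n (w @ [x]) \<longleftrightarrow> (\<exists>m. n = Suc m \<and> is_word k m w) \<and> 1 \<le> x \<and> x \<le> k"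
  by (auto simp: is_word_def)

lemma word_val_less: "is_word k n w \<Longrightarrow> word_val k w < k ^ n"
proof (induction w arbitrary: n rule: rev_induct)
  case (snoc x w)
  then obtain m where m: "n = Suc m" "is_word k m w" "1 \<le> x" "x \<le> k"
    by (auto simp: is_word_snoc)
  have "word_val k w * k + (x - 1) < (word_val k w + 1) * k" using m by simp
  also have "\<dots> \<le> k ^ m * k" using snoc.IH[OF m(2)] by (intro mult_right_mono) auto
  finally show ?case using m by (simp add: mult.commute)
qed (simp add: is_word_def)

lemma word_val_split:
  assumes "is_word k n w" "i \<le> n"
  shows "word_val k w = word_val k (take i w) * k ^ (n - i) + word_val k (drop i w)"
    and "word_val k (drop i w) < k ^ (n - i)"
proof -
  show "word_val k w = word_val k (take i w) * k ^ (n - i) + word_val k (drop i w)"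
    using word_val_append[of k "take i w" "drop i w"] assms by (simp add: is_word_def)
  show "word_val k (drop i w) < k ^ (n - i)"
    using is_word_drop[OF assms(1)] by (rule word_val_less)
qed

lemma div_digit: "d < b \<Longrightarrow> (a * b + d) div b = (a :: nat)"
  by (cases "b = 0") (auto simp: div_mult_self3)

lemma word_val_take:
  assumes "is_word k n w" "i \<le> n"
  shows "word_val k (take i w) = word_val k w div k ^ (n - i)"
  unfolding word_val_split(1)[OF assms]
  using word_val_split(2)[OF assms] by (rule div_digit[symmetric])

lemma word_val_drop:
  assumes "is_word k n w" "i \<le> n"
  shows "word_val k (drop i w) = word_val k w mod k ^ (n - i)"
  using word_val_split[OF assms] by simp

lemma word_val_inj:
  assumes "is_word k n u" "is_word k n v" "word_val k u = word_val k v"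
  shows "u = v"
  using assms
proof (induction u arbitrary: v n rule: rev_induct)
  case Nil
  then show ?case by (simp add: is_word_def)
next
  case (snoc x u)
  then obtain m where m: "n = Suc m" "is_word k m u" "1 \<le> x" "x \<le> k"
    by (auto simp: is_word_snoc)
  obtain v' y where v: "v = v' @ [y]"
    using snoc.prems(2) m(1) by (cases v rule: rev_cases) (auto simp: is_word_def)
  have m': "is_word k m v'" "1 \<le> y" "y \<le> k"
    using snoc.prems(2) m(1) by (auto simp: v is_word_snoc)
  have eq: "word_val k u * k + (x - 1) = word_val k v' * k + (y - 1)"
    using snoc.prems(3) by (simp add: v)
  have "word_val k u = (word_val k u * k + (x - 1)) div k" using m by (intro div_digit[symmetric]) simp
  also have "\<dots> = word_val k v'" unfolding eq using m' by (intro div_digit) simp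
  finally have "u = v'" using snoc.IH[OF m(2) m'(1)] by simp
  moreover have "x = y" using eq \<open>u = v'\<close> m(3) m'(2) by simp
  ultimately show ?case by (simp add: v)
qed

text \<open>Lets the search keep only a number \<open>P < k ^ m\<close> and recover a prefix from it
  when reasoning.\<close>

lemma word_val_surj:
  assumes "P < k ^ m"
  shows "\<exists>p. is_word k m p \<and> word_val k p = P"
  using assms
proof (induction m arbitrary: P)
  case 0
  then show ?case by (auto simp: is_word_def intro: exI[of _ "[]"])
next
  case (Suc m)
  have "P div k < k ^ m" using Suc.prems by (simp add: less_mult_imp_div_less mult.commute)
  then obtain p where p: "is_word k m p" "word_val k p = P div k" using Suc.IH by blast
  have "0 < k" using Suc.prems by (cases k) auto
  then have "is_word k (Suc m) (p @ [P mod k + 1])"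
    using p(1) by (simp add: is_word_snoc Suc_le_eq)
  moreover have "word_val k (p @ [P mod k + 1]) = P" using p(2) by simp
  ultimately show ?case by blast
qed

section \<open>Lexicographic order as numerical order\<close>

lemma word_val_mono:
  assumes u: "is_word k n u" and v: "is_word k n v" and "lex_less u v"
  shows "word_val k u < word_val k v"
proof -
  have "length u = n" "length v = n" using u v by (auto simp: is_word_def)
  then obtain i where i: "i < n" "take i u = take i v" "u ! i < v ! i"
    using assms(3) by (auto simp: lex_less_def)
  have 1: "u ! i \<in> {1..k}" using u i(1) nth_mem[of i u] unfolding is_word_def by blast
  have tu: "word_val k (take (Suc i) u) = word_val k (take i u) * k + (u ! i - 1)"
    using u i by (simp add: take_Suc_conv_app_nth is_word_def)
  have tv: "word_val k (take (Suc i) v) = word_val k (take i u) * k + (v ! i - 1)"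
    using v i by (simp add: take_Suc_conv_app_nth is_word_def)
  have "word_val k (take (Suc i) u) < word_val k (take (Suc i) v)"
  proof -
    have "u ! i - 1 < v ! i - 1" using i(3) 1 by auto
    then show ?thesis unfolding tu tv by (rule add_strict_left_mono)
  qed
  \<comment> \<open>Cutting both words after their first difference is division by a power of
    \<open>k\<close>. Division is monotone, so a strict inequality of quotients forces one of the
    values.\<close>
  then have "(word_val k u) div k ^ (n - Suc i) < (word_val k v) div k ^ (n - Suc i)"
    using i(1) word_val_take[OF u, of "Suc i"] word_val_take[OF v, of "Suc i"] by simp
  then show ?thesis by (metis div_le_mono not_less)
qed

lemma lex_less_total:
  assumes "length u = length v" "u \<noteq> v"
  shows "lex_less u v \<or> lex_less v u"
proof -
  have ex: "\<exists>i. i < length u \<and> u ! i \<noteq> v ! i" using assms by (meson nth_equalityI)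
  define i where "i = (LEAST i. i < length u \<and> u ! i \<noteq> v ! i)"
  have i: "i < length u" "u ! i \<noteq> v ! i" using LeastI_ex[OF ex] by (auto simp: i_def)
  have "u ! j = v ! j" if "j < i" for j
    using not_less_Least[of j "\<lambda>i. i < length u \<and> u ! i \<noteq> v ! i"] that i(1)
    unfolding i_def[symmetric] by auto
  then have "take i u = take i v" using i(1) assms(1) by (intro nth_equalityI) auto
  then show ?thesis using i assms(1) unfolding lex_less_def by (metis linorder_neqE_nat)
qed

lemma lex_less_iff_word_val:
  assumes "is_word k n u" "is_word k n v"
  shows "lex_less u v \<longleftrightarrow> word_val k u < word_val k v"
proof
  show "lex_less u v \<Longrightarrow> word_val k u < word_val k v" using assms by (rule word_val_mono)
  assume lt: "word_val k u < word_val k v"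
  then have "u \<noteq> v" by auto
  then have "lex_less u v \<or> lex_less v u"
    using assms by (intro lex_less_total) (auto simp: is_word_def)
  then show "lex_less u v" using word_val_mono[OF assms(2,1)] lt by auto
qed

text \<open>\<open>Q\<close> is the number of the first \<open>\<mu>\<close> letters of
  \<open>p\<close>. Dropping letters in front is a remainder, keeping letters in front is a
  quotient; both parts have length \<open>\<mu> - (N - b)\<close>, so equal numbers mean equal
  words.\<close>

lemma ext_count_word_val:
  assumes p: "is_word k m p" and b: "1 \<le> b" "2 * b \<le> N"
  defines "\<mu> \<equiv> min m N"
  defines "Q \<equiv> word_val k p div k ^ (m - \<mu>)"
  shows "ext_count k p N b =
    (if \<mu> \<le> N - b then k ^ (N - b - max \<mu> b)
     else if Q mod k ^ (\<mu> - (N - b)) = Q div k ^ (N - b) then 1 else 0)"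
proof -
  have lp: "length p = m" using p by (simp add: is_word_def)
  define q where "q = take \<mu> p"
  have q: "is_word k \<mu> q" using is_word_take[OF p, of \<mu>] by (simp add: q_def \<mu>_def)
  have Q: "word_val k q = Q" unfolding q_def Q_def by (rule word_val_take[OF p]) (simp add: \<mu>_def)
  have tN: "take N p = q" using lp by (simp add: q_def \<mu>_def min_def)
  show ?thesis
  proof (cases "\<mu> \<le> N - b")
    case True
    \<comment> \<open>As \<open>b >= 1\<close>, the case gives \<open>\<mu> < N\<close>, so the
      minimum is not \<open>N\<close>.\<close>
    then have "\<mu> = m" using b by (auto simp: \<mu>_def min_def split: if_splits)
    then show ?thesis using True lp by (simp add: ext_count_def)
  next
    case False
    then have "\<not> m \<le> N - b" by (auto simp: \<mu>_def)
    have "take (\<mu> - (N - b)) p = take (\<mu> - (N - b)) q" by (simp add: q_def)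
    moreover have "drop (N - b) q = take (\<mu> - (N - b)) q \<longleftrightarrow>
       Q mod k ^ (\<mu> - (N - b)) = Q div k ^ (N - b)"
    proof -
      have d: "is_word k (\<mu> - (N - b)) (drop (N - b) q)" using q by (rule is_word_drop)
      have t: "is_word k (\<mu> - (N - b)) (take (\<mu> - (N - b)) q)"
        using is_word_take[OF q, of "\<mu> - (N - b)"] by simp
      have "word_val k (drop (N - b) q) = Q mod k ^ (\<mu> - (N - b))"
        using word_val_drop[OF q, of "N - b"] Q False by simp
      moreover have "word_val k (take (\<mu> - (N - b)) q) = Q div k ^ (N - b)"
        using word_val_take[OF q, of "\<mu> - (N - b)"] Q False by simp
      ultimately show ?thesis using word_val_inj[OF d t] by metis
    qed
    ultimately show ?thesis using False \<open>\<not> m \<le> N - b\<close>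
      unfolding ext_count_def tN lp \<mu>_def[symmetric] by simp
  qed
qed

section \<open>Blocks of consecutive ranks belonging to a prefix\<close>

definition below :: "nat \<Rightarrow> nat \<Rightarrow> nat \<Rightarrow> nat \<Rightarrow> nat" where
  "below n k m P = card {w \<in> unb_words n k. word_val k (take m w) < P}"

lemma finite_unb_words: "finite (unb_words n k)"
  by (rule finite_subset[OF _ finite_words]) (auto simp: unb_words_def)

lemma below_0 [simp]: "below n k m 0 = 0"
  by (simp add: below_def)

text \<open>The unbordered words with prefix \<open>p\<close> form a block of consecutive ranks.
  Counted from zero, it starts at \<open>below n k m (word_val k p)\<close>, and
  \<open>ucount k p n\<close> is its size.\<close>

lemma below_Suc:
  assumes p: "is_word k m p" and m: "m \<le> n"
  shows "below n k m (Suc (word_val k p)) = below n k m (word_val k p) + ucount k p n"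
proof -
  let ?U = "{w \<in> compatible_words k p n. unbordered w}"
  have lp: "length p = m" using p by (simp add: is_word_def)
  have U: "?U = {w \<in> unb_words n k. word_val k (take m w) = word_val k p}"
  proof -
    have "take m w = p \<longleftrightarrow> word_val k (take m w) = word_val k p" if "is_word k n w" for w
    proof -
      have "is_word k m (take m w)" using is_word_take[OF that, of m] m by (simp add: min_absorb1)
      then show ?thesis using word_val_inj[OF _ p] by blast
    qed
    then show ?thesis using lp m by (auto simp: compatible_words_def unb_words_def)
  qed
  have "{w \<in> unb_words n k. word_val k (take m w) < Suc (word_val k p)} =
     {w \<in> unb_words n k. word_val k (take m w) < word_val k p} \<union> ?U"
    unfolding U by auto
  moreover have "card ({w \<in> unb_words n k. word_val k (take m w) < word_val k p} \<union> ?U) =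
     below n k m (word_val k p) + ucount k p n"
    unfolding below_def ucount_def
    by (rule card_Un_disjoint) (auto simp: finite_unb_words finite_compatible_words U)
  ultimately show ?thesis by (simp add: below_def)
qed

text \<open>\<open>P * k\<close> is \<open>P\<close> extended by the smallest letter, and the first
  child's block starts where the parent's does. So going down one level leaves the remaining rank
  unchanged.\<close>

lemma below_mult:
  assumes "m < n"
  shows "below n k (Suc m) (P * k) = below n k m P"
proof -
  have "word_val k (take (Suc m) w) < P * k \<longleftrightarrow> word_val k (take m w) < P" if "is_word k n w" for w
  proof -
    have w: "take (Suc m) w = take m w @ [w ! m]" "w ! m \<in> set w"
      using that assms by (auto simp: is_word_def take_Suc_conv_app_nth)
    then have x: "w ! m - 1 < k" using that by (force simp: is_word_def)
    have "(word_val k (take m w) * k + (w ! m - 1)) div k = word_val k (take m w)"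
      using x by (rule div_digit)
    then show ?thesis using w(1) x
      by (metis div_less_iff_less_mult gr_zeroI not_less_zero word_val_snoc)
  qed
  then show ?thesis unfolding below_def by (intro arg_cong[where f = card]) (auto simp: unb_words_def)
qed

lemma below_all:
  assumes "k ^ m \<le> P" "m \<le> n"
  shows "below n k m P = card (unb_words n k)"
proof -
  have "word_val k (take m w) < P" if "is_word k n w" for w
    using word_val_less[OF is_word_take[OF that, of m]] assms by (simp add: min_absorb1)
  then show ?thesis unfolding below_def by (intro arg_cong[where f = card]) (auto simp: unb_words_def)
qed

text \<open>At full length the count is the test for being unbordered; the search ends on
  it.\<close>

lemma ucount_full:
  assumes "is_word k n p"
  shows "ucount k p n = (if unbordered p then 1 else 0)"
proof -
  have "{w \<in> compatible_words k p n. unbordered w} = (if unbordered p then {p} else {})"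
    using assms by (auto simp: compatible_words_def is_word_def)
  then show ?thesis by (simp add: ucount_def)
qed

lemma has_rank_below:
  assumes p: "is_word k n p" "unbordered p" and r: "below n k n (word_val k p) = r - 1"
  shows "has_rank n k r p"
proof -
  have "lex_less v p \<longleftrightarrow> word_val k (take n v) < word_val k p" if "v \<in> unb_words n k" for v
    using that lex_less_iff_word_val[OF _ p(1), of v]
    by (auto simp: unb_words_def is_word_def)
  then have "{v \<in> unb_words n k. lex_less v p} = {w \<in> unb_words n k. word_val k (take n w) < word_val k p}"
    by auto
  then show ?thesis using p r by (simp add: has_rank_def below_def unb_words_def)
qed

section \<open>Structured programs for the RAM\<close>

text \<open>A loop carries a straight-line block that recomputes its test register before each
  round.\<close>

datatype com =
    Blk "instr list"
  | Seq com com
  | Cond nat com com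
  | While "instr list" nat com

text \<open>Jump targets are absolute, so the first argument is the address at which the code will
  stand.\<close>

fun compile :: "nat \<Rightarrow> com \<Rightarrow> instr list" where
  "compile i (Blk c) = c"
| "compile i (Seq c1 c2) =
     (let p1 = compile i c1 in p1 @ compile (i + length p1) c2)"
| "compile i (Cond r c1 c2) =
     (let p1 = compile (i + 1) c1; p2 = compile (i + 2 + length p1) c2
      in Jz r (i + 2 + length p1) # p1 @ Jmp (i + 2 + length p1 + length p2) # p2)"
| "compile i (While b r c) =
     (let p = compile (i + length b + 1) c
      in b @ Jz r (i + length b + 2 + length p) # p @ [Jmp i])"

fun exec1 :: "instr \<Rightarrow> (nat \<Rightarrow> int) \<Rightarrow> nat \<Rightarrow> int" where
  "exec1 (Const i c) m = m(i := c)"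
| "exec1 (Add i j l) m = m(i := m j + m l)"
| "exec1 (Sub i j l) m = m(i := m j - m l)"
| "exec1 (Mul i j l) m = m(i := m j * m l)"
| "exec1 (Div i j l) m = m(i := m j div m l)"
| "exec1 (Mod i j l) m = m(i := m j mod m l)"
| "exec1 (Less i j l) m = m(i := if m j < m l then 1 else 0)"
| "exec1 (Load i j) m = m(i := m (nat (m j)))"
| "exec1 (Store i j) m = m(nat (m i) := m j)"
| "exec1 _ m = m"

text \<open>Depends on the memory because indirect addresses must be bounded too. The last clause
  rejects jumps and \<open>Halt\<close>, on which \<open>exec1\<close> returns a dummy
  value.\<close>

fun safe1 :: "nat \<Rightarrow> instr \<Rightarrow> (nat \<Rightarrow> int) \<Rightarrow> bool" where
  "safe1 B (Const i c) m \<longleftrightarrow> i < B"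
| "safe1 B (Add i j l) m \<longleftrightarrow> i < B \<and> j < B \<and> l < B"
| "safe1 B (Sub i j l) m \<longleftrightarrow> i < B \<and> j < B \<and> l < B"
| "safe1 B (Mul i j l) m \<longleftrightarrow> i < B \<and> j < B \<and> l < B"
| "safe1 B (Div i j l) m \<longleftrightarrow> i < B \<and> j < B \<and> l < B"
| "safe1 B (Mod i j l) m \<longleftrightarrow> i < B \<and> j < B \<and> l < B"
| "safe1 B (Less i j l) m \<longleftrightarrow> i < B \<and> j < B \<and> l < B"
| "safe1 B (Load i j) m \<longleftrightarrow> i < B \<and> j < B \<and> nat (m j) < B"
| "safe1 B (Store i j) m \<longleftrightarrow> i < B \<and> j < B \<and> nat (m i) < B"
| "safe1 B _ m \<longleftrightarrow> False"

fun exec :: "instr list \<Rightarrow> (nat \<Rightarrow> int) \<Rightarrow> nat \<Rightarrow> int" where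
  "exec [] m = m"
| "exec (c # cs) m = exec cs (exec1 c m)"

fun safe :: "nat \<Rightarrow> instr list \<Rightarrow> (nat \<Rightarrow> int) \<Rightarrow> bool" where
  "safe B [] m \<longleftrightarrow> True"
| "safe B (c # cs) m \<longleftrightarrow> safe1 B c m \<and> safe B cs (exec1 c m)"

definition code_at :: "instr list \<Rightarrow> nat \<Rightarrow> instr list \<Rightarrow> bool" where
  "code_at P i c \<longleftrightarrow> (\<exists>pre post. P = pre @ c @ post \<and> length pre = i)"

text \<open>\<open>runs\<close> describes complete runs only, so a segment of a run is expressed by
  what it adds to every continuation.\<close>

definition reaches :: "nat \<Rightarrow> instr list \<Rightarrow> nat \<Rightarrow> (nat \<Rightarrow> int) \<Rightarrow> nat \<Rightarrow> nat \<Rightarrow> (nat \<Rightarrow> int) \<Rightarrow> bool" where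
  "reaches B P i m t j m' \<longleftrightarrow> (\<forall>A. \<exists>A'. A' \<subseteq> A \<union> {..<B} \<and>
     (\<forall>t2 s. runs P (j, m', A') t2 s \<longrightarrow> runs P (i, m, A) (t + t2) s))"

text \<open>Total correctness: within \<open>t\<close> steps, touching only registers below \<open>B\<close>.\<close>
definition wp :: "nat \<Rightarrow> com \<Rightarrow> nat \<Rightarrow> ((nat \<Rightarrow> int) \<Rightarrow> bool) \<Rightarrow> (nat \<Rightarrow> int) \<Rightarrow> bool" where
  "wp B c t Q m \<longleftrightarrow> (\<forall>P i. code_at P i (compile i c) \<longrightarrow>
     (\<exists>t' m'. t' \<le> t \<and> Q m' \<and> reaches B P i m t' (i + length (compile i c)) m'))"

lemma reaches_refl: "reaches B P i m 0 i m"
  unfolding reaches_def by auto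

lemma reaches_trans:
  assumes "reaches B P i m t j m'" "reaches B P j m' t' l m''"
  shows "reaches B P i m (t + t') l m''"
  unfolding reaches_def
proof
  fix A
  obtain A1 where A1: "A1 \<subseteq> A \<union> {..<B}"
    "\<And>t2 s. runs P (j, m', A1) t2 s \<Longrightarrow> runs P (i, m, A) (t + t2) s"
    using assms(1) unfolding reaches_def by meson
  obtain A2 where A2: "A2 \<subseteq> A1 \<union> {..<B}"
    "\<And>t2 s. runs P (l, m'', A2) t2 s \<Longrightarrow> runs P (j, m', A1) (t' + t2) s"
    using assms(2) unfolding reaches_def by meson
  show "\<exists>A'\<subseteq>A \<union> {..<B}. \<forall>t2 s. runs P (l, m'', A') t2 s \<longrightarrow> runs P (i, m, A) (t + t' + t2) s"
    using A1 A2 by (intro exI[of _ A2]) (auto simp: add.assoc)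
qed

lemma reaches_step:
  assumes "\<And>A. \<exists>A'. A' \<subseteq> A \<union> {..<B} \<and> step P (i, m, A) = Some (j, m', A')"
  shows "reaches B P i m 1 j m'"
  unfolding reaches_def
proof
  fix A
  obtain A' where "A' \<subseteq> A \<union> {..<B}" "step P (i, m, A) = Some (j, m', A')"
    using assms by blast
  then show "\<exists>A'\<subseteq>A \<union> {..<B}. \<forall>t2 s. runs P (j, m', A') t2 s \<longrightarrow> runs P (i, m, A) (1 + t2) s"
    by (intro exI[of _ A']) (auto intro: step_run)
qed

lemma code_at_nth: "code_at P i (c # cs) \<Longrightarrow> i < length P \<and> P ! i = c"
  unfolding code_at_def by auto

lemma code_at_append: "code_at P i (c1 @ c2) \<longleftrightarrow> code_at P i c1 \<and> code_at P (i + length c1) c2"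
proof
  assume "code_at P i (c1 @ c2)"
  then obtain pre post where "P = pre @ (c1 @ c2) @ post" "length pre = i"
    unfolding code_at_def by blast
  then have "P = pre @ c1 @ (c2 @ post)" "P = (pre @ c1) @ c2 @ post" "length pre = i"
     "length (pre @ c1) = i + length c1" by simp_all
  then show "code_at P i c1 \<and> code_at P (i + length c1) c2"
    unfolding code_at_def by blast
next
  assume "code_at P i c1 \<and> code_at P (i + length c1) c2"
  then obtain pre post pre' post' where *: "P = pre @ c1 @ post" "length pre = i"
     "P = pre' @ c2 @ post'" "length pre' = i + length c1" unfolding code_at_def by blast
  then have "pre @ c1 @ post = pre' @ c2 @ post'" by simp
  then have "(pre @ c1) @ post = pre' @ (c2 @ post')" by simp
  then have "pre @ c1 = pre'" using *(2,4) by (subst (asm) append_eq_append_conv) auto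
  then have "P = pre @ (c1 @ c2) @ post'" using *(3) by simp
  then show "code_at P i (c1 @ c2)" using *(2) unfolding code_at_def by blast
qed

lemma code_at_Cons: "code_at P i (c # cs) \<longleftrightarrow> code_at P i [c] \<and> code_at P (Suc i) cs"
  using code_at_append[of P i "[c]" cs] by simp

lemma reaches_exec1:
  assumes "code_at P i [c]" "safe1 B c m"
  shows "reaches B P i m 1 (Suc i) (exec1 c m)"
proof (rule reaches_step)
  fix A
  have c: "\<not> length P \<le> i" "P ! i = c" using code_at_nth[OF assms(1)] by auto
  show "\<exists>A'. A' \<subseteq> A \<union> {..<B} \<and> step P (i, m, A) = Some (Suc i, exec1 c m, A')"
    using assms(2) c by (cases c) (simp_all add: subset_iff)
qed

lemma reaches_exec:
  assumes "code_at P i cs" "safe B cs m"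
  shows "reaches B P i m (length cs) (i + length cs) (exec cs m)"
  using assms
proof (induction cs arbitrary: i m)
  case Nil
  then show ?case by (simp add: reaches_refl)
next
  case (Cons c cs)
  have c: "code_at P i [c]" "code_at P (Suc i) cs" using Cons.prems(1) code_at_Cons[of P i c cs] by blast+
  have "reaches B P i m (1 + length cs) (Suc i + length cs) (exec cs (exec1 c m))"
    using reaches_exec1[OF c(1)] Cons.IH[OF c(2)] Cons.prems(2) by (intro reaches_trans) auto
  then show ?case by simp
qed

lemma reaches_Jz: "code_at P i [Jz r j] \<Longrightarrow> r < B \<Longrightarrow>
   reaches B P i m 1 (if m r = 0 then j else Suc i) m"
  by (drule code_at_nth, intro reaches_step) auto

lemma reaches_Jmp: "code_at P i [Jmp j] \<Longrightarrow> reaches B P i m 1 j m"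
  by (drule code_at_nth, intro reaches_step) auto

section \<open>Proof rules for timed total correctness\<close>

lemma wp_mono:
  assumes "wp B c t Q m" "t \<le> t'" "\<And>m'. Q m' \<Longrightarrow> Q' m'"
  shows "wp B c t' Q' m"
  using assms unfolding wp_def by (meson order_trans)

lemma wp_Blk: "safe B c m \<Longrightarrow> Q (exec c m) \<Longrightarrow> wp B (Blk c) (length c) Q m"
  unfolding wp_def using reaches_exec[of _ _ c B m] by (metis compile.simps(1) order_refl)

lemma wp_Seq:
  assumes "wp B c1 t1 (wp B c2 t2 Q) m"
  shows "wp B (Seq c1 c2) (t1 + t2) Q m"
  unfolding wp_def
proof (intro allI impI)
  fix P i
  let ?p1 = "compile i c1" and ?p2 = "compile (i + length (compile i c1)) c2"
  assume "code_at P i (compile i (Seq c1 c2))"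
  then have c: "code_at P i ?p1" "code_at P (i + length ?p1) ?p2"
    by (simp_all add: Let_def code_at_append)
  obtain t' m' where 1: "t' \<le> t1" "wp B c2 t2 Q m'" "reaches B P i m t' (i + length ?p1) m'"
    using assms c(1) unfolding wp_def[of B c1] by blast
  obtain t'' m'' where 2: "t'' \<le> t2" "Q m''"
     "reaches B P (i + length ?p1) m' t'' (i + length ?p1 + length ?p2) m''"
    using 1(2) c(2) unfolding wp_def by blast
  show "\<exists>t' m'. t' \<le> t1 + t2 \<and> Q m' \<and>
     reaches B P i m t' (i + length (compile i (Seq c1 c2))) m'"
    using 1(1) 2(1,2) reaches_trans[OF 1(3) 2(3)]
    by (intro exI[of _ "t' + t''"] exI[of _ m'']) (auto simp: Let_def add.assoc)
qed

lemma wp_Cond: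
  assumes "r < B" "m r \<noteq> 0 \<Longrightarrow> wp B c1 t Q m" "m r = 0 \<Longrightarrow> wp B c2 t Q m"
  shows "wp B (Cond r c1 c2) (t + 2) Q m"
  unfolding wp_def
proof (intro allI impI)
  fix P i
  let ?p1 = "compile (i + 1) c1"
  let ?p2 = "compile (i + 2 + length ?p1) c2"
  let ?e = "i + 2 + length ?p1 + length ?p2"
  assume "code_at P i (compile i (Cond r c1 c2))"
  then have "code_at P i ([Jz r (i + 2 + length ?p1)] @ ?p1 @ [Jmp ?e] @ ?p2)"
    by (simp add: Let_def)
  then have c: "code_at P i [Jz r (i + 2 + length ?p1)]" "code_at P (i + 1) ?p1"
      "code_at P (i + 1 + length ?p1) [Jmp ?e]" "code_at P (i + 2 + length ?p1) ?p2"
    unfolding code_at_append by (simp_all add: add.commute add.left_commute)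
  have e: "i + length (compile i (Cond r c1 c2)) = ?e" by (simp add: Let_def)
  show "\<exists>t' m'. t' \<le> t + 2 \<and> Q m' \<and>
     reaches B P i m t' (i + length (compile i (Cond r c1 c2))) m'"
  proof (cases "m r = 0")
    case True
    then obtain t' m' where 1: "t' \<le> t" "Q m'" "reaches B P (i + 2 + length ?p1) m t' ?e m'"
      using assms(3) c(4) unfolding wp_def by blast
    have "reaches B P i m 1 (i + 2 + length ?p1) m"
      using reaches_Jz[OF c(1) assms(1), of m] True by simp
    then have "reaches B P i m (1 + t') ?e m'" using 1(3) by (rule reaches_trans)
    then show ?thesis using 1 unfolding e by (intro exI[of _ "1 + t'"] exI[of _ m']) auto
  next
    case False
    then obtain t' m' where 1: "t' \<le> t" "Q m'" "reaches B P (i + 1) m t' (i + 1 + length ?p1) m'"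
      using assms(2) c(2) unfolding wp_def by blast
    have "reaches B P i m 1 (i + 1) m"
      using reaches_Jz[OF c(1) assms(1), of m] False by simp
    then have "reaches B P i m (1 + t' + 1) ?e m'"
      using 1(3) reaches_Jmp[OF c(3)] by (blast intro: reaches_trans)
    then show ?thesis using 1 unfolding e by (intro exI[of _ "1 + t' + 1"] exI[of _ m']) auto
  qed
qed

text \<open>The variant \<open>f\<close> bounds the number of rounds; the extra 1 pays for the final
  failing test. Each round pays 2 for the conditional jump and the jump back.\<close>

lemma wp_While:
  assumes "r < B" and inv: "I m"
    and safe: "\<And>m. I m \<Longrightarrow> safe B b m"
    and exit: "\<And>m. I m \<Longrightarrow> exec b m r = 0 \<Longrightarrow> Q (exec b m)"
    and body: "\<And>m. I m \<Longrightarrow> exec b m r \<noteq> 0 \<Longrightarrow>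
       wp B c t (\<lambda>m'. I m' \<and> f m' < (f m :: nat)) (exec b m)"
  shows "wp B (While b r c) ((f m + 1) * (t + length b + 2)) Q m"
  unfolding wp_def
proof (intro allI impI)
  fix P i
  let ?p = "compile (i + length b + 1) c"
  let ?e = "i + length b + 2 + length ?p"
  assume "code_at P i (compile i (While b r c))"
  then have "code_at P i (b @ [Jz r ?e] @ ?p @ [Jmp i])" by (simp add: Let_def)
  then have c: "code_at P i b" "code_at P (i + length b) [Jz r ?e]"
      "code_at P (i + length b + 1) ?p" "code_at P (i + length b + 1 + length ?p) [Jmp i]"
    unfolding code_at_append by simp_all
  have e: "i + length (compile i (While b r c)) = ?e" by (simp add: Let_def)
  show "\<exists>t' m'. t' \<le> (f m + 1) * (t + length b + 2) \<and> Q m' \<and>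
     reaches B P i m t' (i + length (compile i (While b r c))) m'"
    unfolding e using inv
  proof (induction "f m" arbitrary: m rule: less_induct)
    case less
    have 1: "reaches B P i m (length b) (i + length b) (exec b m)"
      by (rule reaches_exec[OF c(1) safe[OF less.prems]])
    show ?case
    proof (cases "exec b m r = 0")
      case True
      then have "reaches B P i m (length b + 1) ?e (exec b m)"
        using reaches_trans[OF 1 reaches_Jz[OF c(2) assms(1)]] by simp
      then show ?thesis using exit[OF less.prems True]
        by (intro exI[of _ "length b + 1"] exI[of _ "exec b m"]) auto
    next
      case False
      then obtain t1 m1 where 2: "t1 \<le> t" "I m1" "f m1 < f m"
        "reaches B P (i + length b + 1) (exec b m) t1 (i + length b + 1 + length ?p) m1"
        using body[OF less.prems False] c(3) unfolding wp_def by blast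
      obtain t2 m2 where 3: "t2 \<le> (f m1 + 1) * (t + length b + 2)" "Q m2"
        "reaches B P i m1 t2 ?e m2"
        using less.hyps[OF 2(3,2)] by blast
      have "reaches B P i m (length b + 1) (i + length b + 1) (exec b m)"
        using reaches_trans[OF 1 reaches_Jz[OF c(2) assms(1)]] False by simp
      from reaches_trans[OF reaches_trans[OF reaches_trans[OF this 2(4)] reaches_Jmp[OF c(4)]] 3(3)]
      have "reaches B P i m (length b + 1 + t1 + 1 + t2) ?e m2" .
      moreover have "length b + 1 + t1 + 1 + t2 \<le> (f m + 1) * (t + length b + 2)"
      proof -
        have "(f m1 + 1) * (t + length b + 2) \<le> f m * (t + length b + 2)"
          using 2(3) by (intro mult_right_mono) auto
        then show ?thesis using 2(1) 3(1) by simp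
      qed
      ultimately show ?thesis using 3(2) by blast
    qed
  qed
qed

lemma wp_runs:
  assumes "wp B c t Q m"
  shows "\<exists>t' m' A'. t' \<le> t \<and> Q m' \<and> A' \<subseteq> A \<union> {..<B} \<and>
     runs (compile 0 c) (0, m, A) t' (length (compile 0 c), m', A')"
proof -
  let ?P = "compile 0 c"
  have "code_at ?P 0 ?P" unfolding code_at_def by auto
  then obtain t' m' where 1: "t' \<le> t" "Q m'" "reaches B ?P 0 m t' (length ?P) m'"
    using assms unfolding wp_def by (metis add_0)
  then obtain A' where 2: "A' \<subseteq> A \<union> {..<B}"
    "\<And>t2 s. runs ?P (length ?P, m', A') t2 s \<Longrightarrow> runs ?P (0, m, A) (t' + t2) s"
    unfolding reaches_def by meson
  \<comment> \<open>The program stops by running off its end, where \<open>step\<close> yields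
    \<open>None\<close>.\<close>
  have "runs ?P (length ?P, m', A') 0 (length ?P, m', A')" by (rule halt_run) simp
  from 2(2)[OF this] show ?thesis using 1 2(1) by auto
qed

section \<open>The counting program\<close>

text \<open>Register use. Inputs: 1 holds \<open>n\<close>, 2 holds \<open>k\<close>. Search state: 0 is the remaining rank,
  3 and 4 are the number \<open>P\<close> and the length \<open>l\<close> of the current prefix, 17 is cleared when the search
  is over. Counting: 5 is \<open>N\<close>, 6 is \<open>b\<close>, 7 is \<open>\<mu> = min l N\<close>, 8 is the number \<open>Q\<close> of the length-\<open>\<mu>\<close>
  prefix, 9 is the accumulated count, 10 is \<open>N - b\<close>; 11 to 13 are temporary. Constants: 14 holds 1;
  15 and 16 hold the base addresses 20 of the powers of \<open>k\<close> and \<open>21 + n\<close> of the table of counts.\<close>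
definition factor_prog :: com where
  "factor_prog = Cond 11
     (Blk [Sub 11 7 10, Add 11 11 15, Load 11 11, Mod 12 8 11, Add 11 10 15, Load 11 11,
           Div 13 8 11, Less 11 12 13, Less 12 13 12, Add 11 11 12, Sub 12 14 11])
     (Blk [Less 11 7 6, Sub 12 6 7, Mul 11 11 12, Add 11 11 7, Sub 11 10 11, Add 11 11 15,
           Load 12 11])"

definition inner_prog :: com where
  "inner_prog = Seq (Blk [Sub 10 5 6, Less 11 10 7])
     (Seq factor_prog (Blk [Add 11 16 6, Load 11 11, Mul 11 11 12, Sub 9 9 11, Add 6 6 14]))"

definition count_prog :: com where
  "count_prog = Seq (Blk [Const 5 1])
     (While [Less 11 1 5, Sub 11 14 11] 11
       (Seq (Blk [Less 11 5 4, Sub 12 5 4, Mul 11 11 12, Add 7 4 11,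
                  Sub 11 4 7, Add 11 11 15, Load 11 11, Div 8 3 11,
                  Sub 11 5 7, Add 11 11 15, Load 9 11, Const 6 1])
       (Seq (While [Add 11 6 6, Less 11 5 11, Sub 11 14 11] 11 inner_prog)
            (Blk [Add 11 16 5, Store 11 9, Add 5 5 14]))))"

text \<open>The table contents are an arbitrary function \<open>pw\<close>, which keeps the
  arithmetic of powers out of the proofs about the counting program.\<close>

definition env :: "nat \<Rightarrow> nat \<Rightarrow> (nat \<Rightarrow> nat) \<Rightarrow> (nat \<Rightarrow> int) \<Rightarrow> bool" where
  "env n k pw m \<longleftrightarrow> m 1 = int n \<and> m 2 = int k \<and> m 14 = 1 \<and> m 15 = 20 \<and> m 16 = 21 + int n \<and>
     (\<forall>e\<le>n. m (20 + e) = int (pw e))"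

text \<open>Covers inputs, search state, constants and the power table. Counts are stored from
  \<open>22 + n\<close> on, as lengths start at 1.\<close>

definition kept :: "nat \<Rightarrow> (nat \<Rightarrow> int) \<Rightarrow> (nat \<Rightarrow> int) \<Rightarrow> bool" where
  "kept n m m' \<longleftrightarrow> (\<forall>x. x < 5 \<or> 13 < x \<and> x \<le> 21 + n \<longrightarrow> m' x = m x)"

text \<open>The numerical form of \<open>ext_count\<close>, with \<open>j\<close> standing for
  \<open>N - b\<close> and powers looked up in the table.\<close>

definition factor :: "(nat \<Rightarrow> nat) \<Rightarrow> nat \<Rightarrow> nat \<Rightarrow> nat \<Rightarrow> nat \<Rightarrow> nat" where
  "factor pw Q \<mu> j b = (if \<mu> \<le> j then pw (j - max \<mu> b)
     else if Q mod pw (\<mu> - j) = Q div pw j then 1 else 0)"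

lemma envD:
  assumes "env n k pw m"
  shows "m 1 = int n" "m (Suc 0) = int n" "m 2 = int k" "m 14 = 1" "m 15 = 20" "m 16 = 21 + int n"
    "\<And>e. e \<le> n \<Longrightarrow> m (20 + e) = int (pw e)"
  using assms by (auto simp: env_def)

lemma env_kept: "env n k pw m \<Longrightarrow> kept n m m' \<Longrightarrow> env n k pw m'"
  by (auto simp: env_def kept_def)

section \<open>Correctness and cost of the counting program\<close>

lemma wp_factor:
  assumes e: "env n k pw m" and B: "2 * n + 60 \<le> B"
    and r: "m 6 = int b" "m 7 = int \<mu>" "m 8 = int Q" "m 10 = int j" "m 11 = (if j < \<mu> then 1 else 0)"
    and le: "j \<le> n" "\<mu> \<le> n" "b \<le> j"
  shows "wp B factor_prog 13 (\<lambda>m'. m' 12 = int (factor pw Q \<mu> j b) \<and>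
     (\<forall>x. x \<notin> {11, 12, 13} \<longrightarrow> m' x = m x)) m"
  unfolding factor_prog_def
proof (rule wp_mono[OF wp_Cond[where t = 11]])
  show "11 < B" using B by simp
next
  assume "m 11 \<noteq> 0"
  then have j: "j < \<mu>" using r(5) by (simp split: if_splits)
  define d where "d = \<mu> - j"
  have a: "nat (int \<mu> - int j + 20) = 20 + d" "nat (int j + 20) = 20 + j"
    using j by (auto simp: d_def)
  have pw: "m (20 + d) = int (pw d)" "m (20 + j) = int (pw j)"
    using envD(7)[OF e] le by (auto simp: d_def)
  have fac: "factor pw Q \<mu> j b = (if Q mod pw d = Q div pw j then 1 else 0)"
    using j by (simp add: factor_def d_def)
  have "d \<le> n" using le by (simp add: d_def)
  \<comment> \<open>The machine has no equality test: the block subtracts both strict comparisons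
    from 1.\<close>
  show "wp B (Blk [Sub 11 7 10, Add 11 11 15, Load 11 11, Mod 12 8 11, Add 11 10 15, Load 11 11,
           Div 13 8 11, Less 11 12 13, Less 12 13 12, Add 11 11 12, Sub 12 14 11]) 11
     (\<lambda>m'. m' 12 = int (factor pw Q \<mu> j b) \<and> (\<forall>x. x \<notin> {11, 12, 13} \<longrightarrow> m' x = m x)) m"
    using B le \<open>d \<le> n\<close>
    by (intro wp_mono[OF wp_Blk])
       (auto simp: a pw r envD(1-6)[OF e] fac simp flip: of_nat_mod of_nat_div)
next
  assume "m 11 = 0"
  then have j: "\<mu> \<le> j" using r(5) by (simp split: if_splits)
  have a: "nat (int j - int (max \<mu> b) + 20) = 20 + (j - max \<mu> b)"
    using j le by auto
  \<comment> \<open>The program forms the maximum without branching, by multiplying the difference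
    with the outcome of a comparison.\<close>
  have mx: "(if \<mu> < b then 1 else 0) * (int b - int \<mu>) + int \<mu> = int (max \<mu> b)" by auto
  have pw: "m (20 + (j - max \<mu> b)) = int (pw (j - max \<mu> b))"
    using envD(7)[OF e] le by auto
  have lt: "20 + (j - max \<mu> b) < B" using B le by simp
  show "wp B (Blk [Less 11 7 6, Sub 12 6 7, Mul 11 11 12, Add 11 11 7, Sub 11 10 11, Add 11 11 15,
           Load 12 11]) 11
     (\<lambda>m'. m' 12 = int (factor pw Q \<mu> j b) \<and> (\<forall>x. x \<notin> {11, 12, 13} \<longrightarrow> m' x = m x)) m"
    using B j lt
    by (intro wp_mono[OF wp_Blk])
       (simp_all add: mx a pw r envD(1-6)[OF e] factor_def del: of_nat_max)
qed auto

lemma wp_inner: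
  assumes e: "env n k pw m" and B: "2 * n + 60 \<le> B"
    and r: "m 5 = int N" "m 6 = int b" "m 7 = int \<mu>" "m 8 = int Q" "m 9 = S"
    and le: "N \<le> n" "\<mu> \<le> n" "1 \<le> b" "2 * b \<le> N"
    and u: "m (21 + n + b) = int u"
  shows "wp B inner_prog 20 (\<lambda>m'. m' 6 = int (Suc b) \<and>
     m' 9 = S - int u * int (factor pw Q \<mu> (N - b) b) \<and>
     (\<forall>x. x \<notin> {6, 9, 10, 11, 12, 13} \<longrightarrow> m' x = m x)) m"
proof -
  let ?m1 = "exec [Sub 10 5 6, Less 11 10 7] m"
  have m1: "env n k pw ?m1" "?m1 5 = int N" "?m1 6 = int b" "?m1 7 = int \<mu>" "?m1 8 = int Q" "?m1 9 = S"
    "?m1 10 = int (N - b)" "?m1 11 = (if N - b < \<mu> then 1 else 0)" "?m1 (21 + n + b) = int u"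
    "\<And>x. x \<notin> {10, 11} \<Longrightarrow> ?m1 x = m x"
    using r u le e by (auto simp: env_def of_nat_diff)
  have s: "safe B [Sub 10 5 6, Less 11 10 7] m" using B by simp
  have f: "wp B factor_prog 13 (\<lambda>m'. m' 12 = int (factor pw Q \<mu> (N - b) b) \<and>
     (\<forall>x. x \<notin> {11, 12, 13} \<longrightarrow> m' x = ?m1 x)) ?m1"
    using le by (intro wp_factor[OF m1(1) B m1(3,4,5,7,8)]) auto
  have l: "wp B (Blk [Add 11 16 6, Load 11 11, Mul 11 11 12, Sub 9 9 11, Add 6 6 14]) 5
     (\<lambda>m'. m' 6 = int (Suc b) \<and> m' 9 = S - int u * int (factor pw Q \<mu> (N - b) b) \<and>
     (\<forall>x. x \<notin> {6, 9, 10, 11, 12, 13} \<longrightarrow> m' x = m x)) m2"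
    if m2: "m2 12 = int (factor pw Q \<mu> (N - b) b) \<and> (\<forall>x. x \<notin> {11, 12, 13} \<longrightarrow> m2 x = ?m1 x)" for m2
  proof -
    have k: "m2 x = m x" if "x \<notin> {10, 11, 12, 13}" for x using m2 m1(10) that by auto
    have v: "m2 6 = int b" "m2 9 = S" "m2 14 = 1" "m2 16 = 21 + int n" "m2 (21 + n + b) = int u"
      using r u envD[OF e] by (auto simp: k)
    have a: "nat (21 + int n + int b) = 21 + n + b" by simp
    have "safe B [Add 11 16 6, Load 11 11, Mul 11 11 12, Sub 9 9 11, Add 6 6 14] m2"
      using B le by (simp add: v a)
    moreover have "exec [Add 11 16 6, Load 11 11, Mul 11 11 12, Sub 9 9 11, Add 6 6 14] m2 x = m x"
      if "x \<notin> {6, 9, 10, 11, 12, 13}" for x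
      using that by (simp add: k)
    moreover have "exec [Add 11 16 6, Load 11 11, Mul 11 11 12, Sub 9 9 11, Add 6 6 14] m2 6 = int (Suc b)"
      by (simp add: v)
    moreover have "exec [Add 11 16 6, Load 11 11, Mul 11 11 12, Sub 9 9 11, Add 6 6 14] m2 9 =
        S - int u * int (factor pw Q \<mu> (N - b) b)"
      using m2 by (simp add: v a)
    ultimately show ?thesis by (intro wp_mono[OF wp_Blk]) auto
  qed
  have "wp B inner_prog (2 + (13 + 5)) (\<lambda>m'. m' 6 = int (Suc b) \<and>
     m' 9 = S - int u * int (factor pw Q \<mu> (N - b) b) \<and>
     (\<forall>x. x \<notin> {6, 9, 10, 11, 12, 13} \<longrightarrow> m' x = m x)) m"
    unfolding inner_prog_def
    by (intro wp_Seq, rule wp_mono[OF wp_Blk[where Q = "\<lambda>m'. m' = ?m1"]], rule s, rule refl, simp,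
        hypsubst, rule wp_Seq, rule wp_mono[OF f], simp, rule l)
  then show ?thesis by simp
qed

lemma wp_inner_loop:
  assumes e: "env n k pw m" and B: "2 * n + 60 \<le> B"
    and r: "m 5 = int N" "m 6 = 1" "m 7 = int \<mu>" "m 8 = int Q"
    and le: "N \<le> n" "\<mu> \<le> n"
    and u: "\<And>b. 1 \<le> b \<Longrightarrow> b < N \<Longrightarrow> m (21 + n + b) = int (U b)"
  shows "wp B (While [Add 11 6 6, Less 11 5 11, Sub 11 14 11] 11 inner_prog) ((n + 1) * 25)
    (\<lambda>m'. m' 9 = m 9 - (\<Sum>b = 1..N div 2. int (U b) * int (factor pw Q \<mu> (N - b) b)) \<and>
       (\<forall>x. x \<notin> {6, 9, 10, 11, 12, 13} \<longrightarrow> m' x = m x)) m"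
proof -
  let ?g = "\<lambda>b. int (U b) * int (factor pw Q \<mu> (N - b) b)"
  let ?c = "[Add 11 6 6, Less 11 5 11, Sub 11 14 11]"
  define I where "I b m1 \<longleftrightarrow> 1 \<le> b \<and> b \<le> N div 2 + 1 \<and> m1 6 = int b \<and>
     m1 9 = m 9 - sum ?g {1..<b} \<and> (\<forall>x. x \<notin> {6, 9, 10, 11, 12, 13} \<longrightarrow> m1 x = m x)" for b m1
  define f where "f m1 = N div 2 + 1 - nat (m1 6)" for m1 :: "nat \<Rightarrow> int"
  have c: "exec ?c m1 11 = (if 2 * b \<le> N then 1 else 0)" "\<And>x. x \<noteq> 11 \<Longrightarrow> exec ?c m1 x = m1 x"
    if "I b m1" for b m1
    using that r envD[OF e] by (auto simp: I_def)
  have "wp B (While ?c 11 inner_prog) ((f m + 1) * (20 + length ?c + 2))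
    (\<lambda>m'. m' 9 = m 9 - sum ?g {1..N div 2} \<and>
       (\<forall>x. x \<notin> {6, 9, 10, 11, 12, 13} \<longrightarrow> m' x = m x)) m"
  proof (rule wp_While[where I = "\<lambda>m. \<exists>b. I b m"])
    show "11 < B" using B by simp
    show "\<exists>b. I b m" using r by (intro exI[of _ 1]) (simp add: I_def)
  next
    fix m1 assume "\<exists>b. I b m1"
    show "safe B ?c m1" using B by simp
  next
    fix m1 assume "\<exists>b. I b m1" and z: "exec ?c m1 11 = 0"
    then obtain b where b: "I b m1" by blast
    have "\<not> 2 * b \<le> N" using c(1)[OF b] z by (simp split: if_splits)
    then have "b = Suc (N div 2)" using b by (auto simp: I_def)
    then show "exec ?c m1 9 = m 9 - sum ?g {1..N div 2} \<and>
       (\<forall>x. x \<notin> {6, 9, 10, 11, 12, 13} \<longrightarrow> exec ?c m1 x = m x)"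
      using b c(2)[OF b] by (simp add: I_def atLeastLessThanSuc_atLeastAtMost)
  next
    fix m1 assume "\<exists>b. I b m1" and z: "exec ?c m1 11 \<noteq> 0"
    then obtain b where b: "I b m1" by blast
    have bN: "2 * b \<le> N" using c(1)[OF b] z by (simp split: if_splits)
    let ?m = "exec ?c m1"
    have b1: "1 \<le> b" "m1 6 = int b" "m1 9 = m 9 - sum ?g {1..<b}"
      and fr: "\<And>x. x \<notin> {6, 9, 10, 11, 12, 13} \<Longrightarrow> ?m x = m x"
      using b c(2)[OF b] by (auto simp: I_def)
    have e': "env n k pw ?m" using e unfolding env_def by (simp add: fr del: exec.simps)
    have s: "?m 5 = int N" "?m 6 = int b" "?m 7 = int \<mu>" "?m 8 = int Q" "?m 9 = m 9 - sum ?g {1..<b}"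
       "?m (21 + n + b) = int (U b)"
      using r u[of b] b1 bN by (simp_all add: fr c(2)[OF b] del: exec.simps)
    show "wp B inner_prog 20 (\<lambda>m'. (\<exists>b. I b m') \<and> f m' < f m1) ?m"
    proof (rule wp_mono[OF wp_inner[OF e' B s(1-5) le b1(1) bN s(6)] order_refl])
      fix m2 assume m2: "m2 6 = int (Suc b) \<and> m2 9 = m 9 - sum ?g {1..<b} - ?g b \<and>
        (\<forall>x. x \<notin> {6, 9, 10, 11, 12, 13} \<longrightarrow> m2 x = ?m x)"
      then have "I (Suc b) m2" using b1(1) bN fr
        unfolding I_def by (auto simp del: exec.simps)
      moreover have "f m2 < f m1" using m2 b1(2) bN by (auto simp: f_def)
      ultimately show "(\<exists>b. I b m2) \<and> f m2 < f m1" by blast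
    qed
  qed
  moreover have "(f m + 1) * (20 + length ?c + 2) \<le> (n + 1) * 25"
    using r(2) le(1) by (simp add: f_def)
  ultimately show ?thesis by (rule wp_mono) 
qed

text \<open>Lengths are treated in increasing order, so all entries for \<open>b <= N div 2\<close>
  are present when \<open>N\<close> is reached. \<open>U\<close> is any solution of the recurrence;
  the words enter only later.\<close>

lemma wp_count:
  assumes e: "env n k pw m" and B: "2 * n + 60 \<le> B"
    and r: "m 3 = int P" "m 4 = int l" and l: "l \<le> n"
    and U: "\<And>N. 1 \<le> N \<Longrightarrow> N \<le> n \<Longrightarrow> int (U N) = int (pw (N - l)) -
      (\<Sum>b = 1..N div 2. int (U b) *
         int (factor pw (P div pw (l - min l N)) (min l N) (N - b) b))"
  shows "wp B count_prog ((n + 1) * (25 * (n + 1) + 20))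
     (\<lambda>m'. kept n m m' \<and> (\<forall>b. 1 \<le> b \<longrightarrow> b \<le> n \<longrightarrow> m' (21 + n + b) = int (U b))) m"
proof -
  let ?c = "[Less 11 1 5, Sub 11 14 11]"
  let ?b1 = "[Less 11 5 4, Sub 12 5 4, Mul 11 11 12, Add 7 4 11,
                  Sub 11 4 7, Add 11 11 15, Load 11 11, Div 8 3 11,
                  Sub 11 5 7, Add 11 11 15, Load 9 11, Const 6 1]"
  let ?w = "While [Add 11 6 6, Less 11 5 11, Sub 11 14 11] 11 inner_prog"
  let ?b2 = "[Add 11 16 5, Store 11 9, Add 5 5 14]"
  define I where "I N m1 \<longleftrightarrow> 1 \<le> N \<and> N \<le> n + 1 \<and> m1 5 = int N \<and> kept n m m1 \<and>
     (\<forall>b. 1 \<le> b \<longrightarrow> b < N \<longrightarrow> m1 (21 + n + b) = int (U b))" for N m1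
  define f where "f m1 = n + 1 - nat (m1 5)" for m1 :: "nat \<Rightarrow> int"
  let ?Q = "\<lambda>m'. kept n m m' \<and> (\<forall>b. 1 \<le> b \<longrightarrow> b \<le> n \<longrightarrow> m' (21 + n + b) = int (U b))"
  have c: "exec ?c m1 11 = (if N \<le> n then 1 else 0)" "\<And>x. x \<noteq> 11 \<Longrightarrow> exec ?c m1 x = m1 x"
    if "I N m1" for N m1
  proof -
    have "env n k pw m1" using that e env_kept by (auto simp: I_def)
    from envD[OF this] show "exec ?c m1 11 = (if N \<le> n then 1 else 0)"
      using that by (simp add: I_def)
  qed simp
  have loop: "wp B (While ?c 11 (Seq (Blk ?b1) (Seq ?w (Blk ?b2))))
       ((f m1 + 1) * (12 + ((n + 1) * 25 + 3) + length ?c + 2)) ?Q m1" if "I 1 m1" for m1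
  proof (rule wp_While[where I = "\<lambda>m. \<exists>N. I N m"])
    show "11 < B" using B by simp
    show "\<exists>N. I N m1" using that by blast
  next
    fix m1 show "safe B ?c m1" using B by simp
  next
    fix m1 assume "\<exists>N. I N m1" and z: "exec ?c m1 11 = 0"
    then obtain N where N: "I N m1" by blast
    have "N = n + 1" using c(1)[OF N] z N by (simp add: I_def split: if_splits)
    then show "?Q (exec ?c m1)" using N c(2)[OF N]
      by (simp add: I_def kept_def del: exec.simps)
  next
    fix m1 assume "\<exists>N. I N m1" and z: "exec ?c m1 11 \<noteq> 0"
    then obtain N where N: "I N m1" by blast
    have Nn: "N \<le> n" using c(1)[OF N] z by (simp split: if_splits)
    define m2 where "m2 = exec ?c m1"
    define m3 where "m3 = exec ?b1 m2"
    have m2: "\<And>x. x \<noteq> 11 \<Longrightarrow> m2 x = m1 x" using c(2)[OF N] by (simp add: m2_def)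
    have N1: "1 \<le> N" "m1 5 = int N" "kept n m m1" using N by (auto simp: I_def)
    have k2: "kept n m m2" using N1(3) m2 by (auto simp: kept_def)
    have e2: "env n k pw m2" using e k2 by (rule env_kept)
    have v: "m2 3 = int P" "m2 4 = int l" "m2 5 = int N"
      using r k2 N1 m2[of 5] by (auto simp: kept_def)
    let ?\<mu> = "min l N"
    \<comment> \<open>The branch-free minimum, in the two shapes in which the simplifier may meet
      the comparison.\<close>
    have mu: "int l + (if int N < int l then 1 else 0) * (int N - int l) = int ?\<mu>" by auto
    have mu': "int l + (if N < l then 1 else 0) * (int N - int l) = int ?\<mu>" by auto
    \<comment> \<open>Table indices: entry \<open>d\<close> cuts the prefix number down to
      \<open>\<mu>\<close> letters, entry \<open>d'\<close> starts the count. Subtracting the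
      minimum on the machine yields the truncated \<open>N - l\<close>.\<close>
    define d where "d = l - ?\<mu>"
    define d' where "d' = N - l"
    have a: "nat (int l - int ?\<mu> + 20) = 20 + d" "nat (int N - int ?\<mu> + 20) = 20 + d'"
      by (auto simp: d_def d'_def)
    have lt: "d \<le> n" "d' \<le> n" using l Nn by (auto simp: d_def d'_def)
    have pw: "m2 (20 + d) = int (pw d)" "m2 (20 + d') = int (pw d')"
      using lt by (simp_all only: envD(7)[OF e2])
    have s: "safe B ?b1 m2" using B lt
      by (simp add: envD(1-6)[OF e2] v mu mu' a del: of_nat_min)
    have m3': "m3 7 = int ?\<mu>" "m3 8 = int (P div pw d)" "m3 9 = int (pw d')" "m3 6 = 1"
      "m3 5 = int N" "\<And>x. x \<notin> {6, 7, 8, 9, 11, 12} \<Longrightarrow> m3 x = m1 x"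
      using lt unfolding m3_def
      by (simp_all add: envD(1-6)[OF e2] v mu mu' a pw m2 zdiv_int del: of_nat_min)
    note m3 = m3'[unfolded d_def d'_def]
    have k3: "kept n m m3" using N1(3) m3(6) by (simp add: kept_def)
    have e3: "env n k pw m3" using e k3 by (rule env_kept)
    have u3: "m3 (21 + n + b) = int (U b)" if "1 \<le> b" "b < N" for b
      using N that m3(6) by (simp add: I_def)
    have mn: "?\<mu> \<le> n" using l by simp
    show "wp B (Seq (Blk ?b1) (Seq ?w (Blk ?b2))) (12 + ((n + 1) * 25 + 3))
       (\<lambda>m'. (\<exists>N. I N m') \<and> f m' < f m1) (exec ?c m1)"
      unfolding m2_def[symmetric]
    proof (rule wp_Seq, rule wp_mono[OF wp_Blk[where Q = "\<lambda>m'. m' = m3"]])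
      show "safe B ?b1 m2" by (rule s)
      show "exec ?b1 m2 = m3" by (simp only: m3_def)
      show "length ?b1 \<le> 12" by simp
      fix m' assume "m' = m3"
      show "wp B (Seq ?w (Blk ?b2)) ((n + 1) * 25 + 3) (\<lambda>m'. (\<exists>N. I N m') \<and> f m' < f m1) m'"
        unfolding \<open>m' = m3\<close>
      proof (rule wp_Seq, rule wp_mono[OF wp_inner_loop[OF e3 B m3(5,4,1,2) Nn mn u3] order_refl])
        fix m4 assume *: "m4 9 = m3 9 - (\<Sum>b = 1..N div 2. int (U b) *
             int (factor pw (P div pw (l - min l N)) (min l N) (N - b) b)) \<and>
           (\<forall>x. x \<notin> {6, 9, 10, 11, 12, 13} \<longrightarrow> m4 x = m3 x)"
        then have 9: "m4 9 = int (U N)" using U[OF N1(1) Nn] m3(3) by simp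
        have k4: "kept n m m4" using * k3 by (simp add: kept_def)
        have e4: "env n k pw m4" using e k4 by (rule env_kept)
        have 5: "m4 5 = int N" using * m3(5) by simp
        have u4: "m4 (21 + n + b) = int (U b)" if "1 \<le> b" "b < N" for b
          using u3[OF that] * by simp
        let ?m5 = "exec ?b2 m4"
        have a': "nat (21 + int n + int N) = 21 + n + N" by simp
        have m5: "?m5 x = (if x = 5 then int (Suc N) else if x = 21 + n + N then int (U N)
             else if x = 11 then 21 + int n + int N else m4 x)" for x
          by (simp add: envD(1-6)[OF e4] 5 9 a')
        have "I (Suc N) ?m5"
          unfolding I_def kept_def m5 using Nn N1(1) k4 u4 by (auto simp: kept_def less_Suc_eq)
        moreover have "f ?m5 < f m1" unfolding f_def m5 using N1(2) Nn by simp
        moreover have "safe B ?b2 m4" using B Nn by (simp add: envD(1-6)[OF e4] 5 a')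
        ultimately show "wp B (Blk ?b2) 3 (\<lambda>m'. (\<exists>N. I N m') \<and> f m' < f m1) m4"
          by (intro wp_mono[OF wp_Blk[where Q = "\<lambda>m'. m' = ?m5"]]) auto
      qed auto
    qed
  qed
  let ?m1 = "m(5 := 1)"
  have "I 1 ?m1" by (simp add: I_def kept_def)
  from loop[OF this]
  have "wp B count_prog (1 + ((f ?m1 + 1) * (12 + ((n + 1) * 25 + 3) + length ?c + 2))) ?Q m"
    unfolding count_prog_def using B
    by (intro wp_Seq wp_mono[OF wp_Blk[where Q = "\<lambda>m'. m' = ?m1"]]) auto
  moreover have "1 + ((f ?m1 + 1) * (12 + ((n + 1) * 25 + 3) + length ?c + 2)) \<le>
     (n + 1) * (25 * (n + 1) + 20)"
    by (simp add: f_def algebra_simps)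
  ultimately show ?thesis by (rule wp_mono)
qed

section \<open>The unranking program\<close>

definition power_prog :: com where
  "power_prog = While [Less 11 1 5, Sub 11 14 11] 11
     (Blk [Add 11 15 5, Store 11 9, Mul 9 9 2, Add 5 5 14])"

text \<open>Register 9 receives the count for length \<open>n\<close>. The comparison with it asks
  whether the wanted word has the current prefix; if so, register 17 serves both as the test for a
  missing letter and as the loop flag.\<close>

definition search_prog :: com where
  "search_prog = While [] 17
     (Seq count_prog
     (Seq (Blk [Add 11 16 1, Load 9 11, Less 11 0 9])
          (Cond 11 (Seq (Blk [Less 17 4 1]) (Cond 17 (Blk [Mul 3 3 2, Add 4 4 14]) (Blk [])))
                 (Blk [Sub 0 0 9, Add 3 3 14]))))"

text \<open>Letters come off from the last to the first. Positions from 20 on lie above the working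
  registers and are filled at once, overwriting the power table, which is not read any more.\<close>

definition decode_prog :: com where
  "decode_prog = While [] 5
     (Seq (Blk [Sub 5 5 14, Mod 11 3 2, Add 11 11 14, Div 3 3 2, Add 12 16 5, Store 12 11,
                Const 12 20, Less 12 5 12])
          (Cond 12 (Blk []) (Blk [Store 5 11])))"

text \<open>The output occupies the working registers too. So the letters are first written to
  \<open>21 + n + j\<close>, and once register 0 holds \<open>21 + n\<close>, each register \<open>i < 20\<close> is turned into a pointer to
  its own letter and dereferenced in place, register 0 last.\<close>
definition fetch :: "nat \<Rightarrow> instr list" where
  "fetch c = concat (map (\<lambda>i. [Const i (int i), Add i i 0, Load i i]) [1..<c])"

text \<open>\<open>Sub 0 0 14\<close> makes the rank start at 0. Adding a register that holds 0
  serves as a copy instruction.\<close>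

definition unrank_prog :: com where
  "unrank_prog = Seq (Blk [Const 14 1, Sub 0 0 14, Const 3 0, Const 4 0, Const 15 20, Add 16 15 1,
        Add 16 16 14, Const 17 1, Const 5 0, Const 9 1])
     (Seq power_prog (Seq search_prog (Seq (Blk [Const 11 0, Add 5 1 11]) (Seq decode_prog
       (Blk ([Const 11 0, Add 0 16 11] @ fetch 20 @ [Load 0 0]))))))"

lemma wp_power:
  assumes B: "2 * n + 60 \<le> B"
    and r: "m 1 = int n" "m 2 = int k" "m 14 = 1" "m 15 = 20" "m 16 = 21 + int n" "m 5 = 0" "m 9 = 1"
  shows "wp B power_prog ((n + 2) * 8) (\<lambda>m'. env n k (\<lambda>e. k ^ e) m' \<and>
     (\<forall>x\<in>{0, 3, 4, 17}. m' x = m x)) m"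
proof -
  let ?c = "[Less 11 1 5, Sub 11 14 11]"
  let ?b = "[Add 11 15 5, Store 11 9, Mul 9 9 2, Add 5 5 14]"
  define I where "I e m1 \<longleftrightarrow> e \<le> n + 1 \<and> m1 5 = int e \<and> m1 9 = int (k ^ e) \<and>
     (\<forall>i<e. m1 (20 + i) = int (k ^ i)) \<and>
     (\<forall>x\<in>{0, 1, 2, 3, 4, 14, 15, 16, 17}. m1 x = m x)" for e m1
  define f where "f m1 = n + 1 - nat (m1 5)" for m1 :: "nat \<Rightarrow> int"
  have c: "exec ?c m1 11 = (if e \<le> n then 1 else 0)" "\<And>x. x \<noteq> 11 \<Longrightarrow> exec ?c m1 x = m1 x"
    if "I e m1" for e m1
    using that r by (auto simp: I_def)
  have "wp B power_prog ((f m + 1) * (4 + length ?c + 2)) (\<lambda>m'. env n k (\<lambda>e. k ^ e) m' \<and>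
     (\<forall>x\<in>{0, 3, 4, 17}. m' x = m x)) m"
    unfolding power_prog_def
  proof (rule wp_While[where I = "\<lambda>m. \<exists>e. I e m"])
    show "11 < B" using B by simp
    show "\<exists>e. I e m" using r by (intro exI[of _ 0]) (simp add: I_def)
  next
    fix m1 show "safe B ?c m1" using B by simp
  next
    fix m1 assume "\<exists>e. I e m1" and z: "exec ?c m1 11 = 0"
    then obtain e where e: "I e m1" by blast
    have "e = n + 1" using c(1)[OF e] z e by (simp add: I_def split: if_splits)
    then show "env n k (\<lambda>e. k ^ e) (exec ?c m1) \<and> (\<forall>x\<in>{0, 3, 4, 17}. exec ?c m1 x = m x)"
      using e r c(2)[OF e] by (simp add: I_def env_def del: exec.simps of_nat_power)
  next
    fix m1 assume "\<exists>e. I e m1" and z: "exec ?c m1 11 \<noteq> 0"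
    then obtain e where e: "I e m1" by blast
    have en: "e \<le> n" using c(1)[OF e] z by (simp split: if_splits)
    define m2 where "m2 = exec ?c m1"
    have e2: "I e m2" using e c(2)[OF e] by (simp add: I_def m2_def del: exec.simps)
    define p where "p = k ^ e"
    have v: "m2 5 = int e" "m2 9 = int p" "m2 2 = int k" "m2 14 = 1" "m2 15 = 20"
      using e2 r by (auto simp: I_def p_def)
    have a: "nat (20 + int e) = 20 + e" by simp
    have s: "safe B ?b m2" using B en by (simp add: v a)
    have m3: "exec ?b m2 x = (if x = 5 then int (Suc e) else if x = 9 then int (p * k)
       else if x = 20 + e then int p else if x = 11 then 20 + int e else m2 x)" for x
      by (simp add: v a)
    have "I (Suc e) (exec ?b m2)"
      unfolding I_def m3 using e2 en by (auto simp: I_def p_def less_Suc_eq)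
    moreover have "f (exec ?b m2) < f m1"
      unfolding f_def m3 using e en by (simp add: I_def)
    ultimately show "wp B (Blk ?b) 4 (\<lambda>m'. (\<exists>e. I e m') \<and> f m' < f m1) (exec ?c m1)"
      unfolding m2_def[symmetric] using s
      by (intro wp_mono[OF wp_Blk[where Q = "\<lambda>m'. m' = exec ?b m2"]]) auto
  qed
  then show ?thesis by (rule wp_mono) (simp_all add: f_def r)
qed

text \<open>If \<open>Suc P\<close> were \<open>k ^ l\<close>, all unbordered words would lie below
  it. If the last letter were maximal, \<open>Suc P\<close> would be the first child of the parent's
  successor, so its block would start where the parent's ends, and by \<open>par\<close> that is
  beyond the wanted rank.\<close>

lemma search_incr:
  assumes r: "r - 1 < card (unb_words n k)" and P: "P < k ^ l" and l: "l \<le> n"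
    and ge: "below n k l (Suc P) \<le> r - 1"
    and par: "0 < l \<Longrightarrow> r - 1 < below n k (l - 1) (P div k + 1)"
  shows "Suc P < k ^ l" "0 < l" "Suc P mod k = Suc (P mod k)" "Suc P div k = P div k"
proof -
  show P': "Suc P < k ^ l"
  proof (rule ccontr)
    assume "\<not> Suc P < k ^ l"
    then have "below n k l (Suc P) = card (unb_words n k)" by (intro below_all l) simp
    then show False using r ge by simp
  qed
  then show l0: "0 < l" by (cases l) auto
  have "Suc (P mod k) \<noteq> k"
  proof
    assume *: "Suc (P mod k) = k"
    have "Suc P = P div k * k + P mod k + 1" by simp
    also have "\<dots> = (P div k + 1) * k" using * by (metis Suc_eq_plus1 add.assoc add_mult_distrib mult_1)
    finally have "below n k l (Suc P) = below n k (Suc (l - 1)) ((P div k + 1) * k)" using l0 by simp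
    also have "\<dots> = below n k (l - 1) (P div k + 1)" using l0 l by (intro below_mult) simp
    finally show False using par[OF l0] ge by simp
  qed
  then show "Suc P mod k = Suc (P mod k)" "Suc P div k = P div k"
    by (simp_all add: mod_Suc div_Suc)
qed

text \<open>Instantiates the recurrence: \<open>ucount_rec\<close> supplies it,
  \<open>ext_count_word_val\<close> its coefficients.\<close>

lemma wp_count_word:
  assumes e: "env n k (\<lambda>e. k ^ e) m" and B: "2 * n + 60 \<le> B"
    and p: "is_word k l p" and r: "m 3 = int (word_val k p)" "m 4 = int l" and l: "l \<le> n"
    and n: "1 \<le> n"
  shows "wp B count_prog ((n + 1) * (25 * (n + 1) + 20))
     (\<lambda>m'. kept n m m' \<and> m' (21 + n + n) = int (ucount k p n)) m"
proof (rule wp_mono[OF wp_count[OF e B r l, where U = "ucount k p"] order_refl])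
  fix N assume "1 \<le> N" "N \<le> n"
  have lp: "length p = l" using p by (simp add: is_word_def)
  have "int (ucount k p N) = int (k ^ (N - length p)) -
     (\<Sum>b = 1..N div 2. int (ucount k p b) * int (ext_count k p N b))"
    by (rule ucount_rec) (simp add: lp p)
  also have "(\<Sum>b = 1..N div 2. int (ucount k p b) * int (ext_count k p N b)) =
     (\<Sum>b = 1..N div 2. int (ucount k p b) * int (factor (\<lambda>e. k ^ e)
        (word_val k p div k ^ (l - min l N)) (min l N) (N - b) b))"
  proof (rule sum.cong)
    fix b assume "b \<in> {1..N div 2}"
    then have "1 \<le> b" "2 * b \<le> N" by auto
    then have "ext_count k p N b =
        factor (\<lambda>e. k ^ e) (word_val k p div k ^ (l - min l N)) (min l N) (N - b) b"
      unfolding factor_def by (rule ext_count_word_val[OF p])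
    then show "int (ucount k p b) * int (ext_count k p N b) = int (ucount k p b) *
        int (factor (\<lambda>e. k ^ e) (word_val k p div k ^ (l - min l N)) (min l N) (N - b) b)"
      by (simp only:)
  qed simp
  finally show "int (ucount k p N) = int (k ^ (N - l)) - (\<Sum>b = 1..N div 2. int (ucount k p b) *
     int (factor (\<lambda>e. k ^ e) (word_val k p div k ^ (l - min l N)) (min l N) (N - b) b))"
    by (simp add: lp)
qed (use n in auto)

lemma wp_search:
  assumes e: "env n k (\<lambda>e. k ^ e) m" and B: "2 * n + 60 \<le> B"
    and v: "m 0 = int (r - 1)" "m 3 = 0" "m 4 = 0" "m 17 = 1"
    and r: "r - 1 < card (unb_words n k)" and n: "1 \<le> n" and k: "2 \<le> k"
  shows "wp B search_prog ((n * k + k + 1) * ((n + 1) * (25 * (n + 1) + 20) + 12))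
    (\<lambda>m'. env n k (\<lambda>e. k ^ e) m' \<and> (\<exists>w. has_rank n k r w \<and> m' 3 = int (word_val k w))) m"
proof -
  let ?T = "(n + 1) * (25 * (n + 1) + 20)"
  let ?c1 = "[Add 11 16 1, Load 9 11, Less 11 0 9]"
  \<comment> \<open>\<open>R\<close> is the wanted rank relative to the start of the block of
    \<open>P\<close>. Together with the parent condition this places the wanted word in the parent's
    block, though possibly at a later sibling. A cleared register 17 records that the block of a
    full-length \<open>P\<close> contains it.\<close>
  define J where "J R P l m1 \<longleftrightarrow> env n k (\<lambda>e. k ^ e) m1 \<and> m1 0 = int R \<and> m1 3 = int P \<and>
     m1 4 = int l \<and> l \<le> n \<and> P < k ^ l \<and> R + below n k l P = r - 1 \<and>
     (0 < l \<longrightarrow> r - 1 < below n k (l - 1) (P div k + 1)) \<and>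
     (m1 17 = 1 \<or> m1 17 = 0 \<and> l = n \<and> r - 1 < below n k n (Suc P))" for R P l m1
  define I where "I m1 \<longleftrightarrow> (\<exists>R P l. J R P l m1)" for m1
  \<comment> \<open>The parent condition in \<open>J\<close> keeps \<open>P mod k\<close> from wrapping around, so that \<open>f\<close> decreases.\<close>
  define f where "f m1 = (if m1 17 = 0 then 0 else 1 + (n - nat (m1 4)) * k + (k - 1 - nat (m1 3) mod k))"
    for m1 :: "nat \<Rightarrow> int"
  have "wp B search_prog ((f m + 1) * (?T + (3 + 7) + length ([] :: instr list) + 2))
    (\<lambda>m'. env n k (\<lambda>e. k ^ e) m' \<and> (\<exists>w. has_rank n k r w \<and> m' 3 = int (word_val k w))) m"
    unfolding search_prog_def
  proof (rule wp_While[where I = I])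
    show "17 < B" using B by simp
    have "J (r - 1) 0 0 m" using e v by (simp add: J_def)
    then show "I m" by (auto simp: I_def)
  next
    fix m1 show "safe B [] m1" by simp
  next
    fix m1 assume "I m1" and z: "exec [] m1 17 = 0"
    then obtain R P l where J: "J R P l m1" by (auto simp: I_def)
    then have *: "l = n" "r - 1 < below n k n (Suc P)" "P < k ^ n" "R + below n k n P = r - 1"
      using z by (auto simp: J_def)
    obtain p where p: "is_word k n p" "word_val k p = P" using word_val_surj[OF *(3)] by blast
    have "below n k n (Suc P) = below n k n P + ucount k p n"
      using below_Suc[OF p(1), of n] p(2) by simp
    \<comment> \<open>At full length the count is 0 or 1, so this forces \<open>p\<close> to be
      unbordered and \<open>R\<close> to be 0.\<close>
    then have "R < ucount k p n" using *(2,4) by simp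
    then have "unbordered p" "R = 0" by (auto simp: ucount_full[OF p(1)] split: if_splits)
    then have "has_rank n k r p" using *(4) p by (intro has_rank_below) auto
    then show "env n k (\<lambda>e. k ^ e) (exec [] m1) \<and>
       (\<exists>w. has_rank n k r w \<and> exec [] m1 3 = int (word_val k w))"
      using J p(2) by (auto simp: J_def)
  next
    fix m1 assume "I m1" and z: "exec [] m1 17 \<noteq> 0"
    then obtain R P l where J: "J R P l m1" by (auto simp: I_def)
    have e1: "env n k (\<lambda>e. k ^ e) m1" and v1: "m1 0 = int R" "m1 3 = int P" "m1 4 = int l" "m1 17 = 1"
      and l: "l \<le> n" and P: "P < k ^ l" and R: "R + below n k l P = r - 1"
      and par: "0 < l \<Longrightarrow> r - 1 < below n k (l - 1) (P div k + 1)"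
      using J z by (auto simp: J_def)
    obtain p where p: "is_word k l p" "word_val k p = P" using word_val_surj[OF P] by blast
    define u where "u = ucount k p n"
    have bS: "below n k l (Suc P) = below n k l P + u"
      using below_Suc[OF p(1) l] p(2) by (simp add: u_def)
    have f1: "f m1 = 1 + (n - l) * k + (k - 1 - P mod k)" using v1 by (simp add: f_def)
    let ?c2 = "Cond 11 (Seq (Blk [Less 17 4 1]) (Cond 17 (Blk [Mul 3 3 2, Add 4 4 14]) (Blk [])))
                 (Blk [Sub 0 0 9, Add 3 3 14])"
    have step: "wp B (Seq (Blk ?c1) ?c2) (3 + 7) (\<lambda>m'. I m' \<and> f m' < f m1) m2"
      if "kept n m1 m2 \<and> m2 (21 + n + n) = int u" for m2
    proof -
      have e2: "env n k (\<lambda>e. k ^ e) m2" using that e1 env_kept by blast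
      have v2: "m2 0 = int R" "m2 3 = int P" "m2 4 = int l" "m2 17 = 1"
        using that v1 by (auto simp: kept_def)
      define h where "h = 21 + n + n"
      have u2: "m2 h = int u" using that by (simp add: h_def)
      define m3 where "m3 = exec ?c1 m2"
      have a: "nat (2 * int n + 21) = h" "h \<noteq> 11" "h < B" using B by (auto simp: h_def)
      have s: "safe B ?c1 m2" using B a(3) by (simp add: envD(1-6)[OF e2] a)
      have m3: "m3 9 = int u" "m3 11 = (if R < u then 1 else 0)" "\<And>x. x \<notin> {9, 11} \<Longrightarrow> m3 x = m2 x"
        unfolding m3_def by (simp_all add: envD(1-6)[OF e2] a v2 u2)
      have e3: "env n k (\<lambda>e. k ^ e) m3" using e2 unfolding env_def by (simp add: m3(3))
      have v3: "m3 0 = int R" "m3 3 = int P" "m3 4 = int l" "m3 17 = 1" using v2 by (simp_all add: m3(3))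
      have "wp B ?c2 (5 + 2) (\<lambda>m'. I m' \<and> f m' < f m1) m3"
      proof (rule wp_Cond)
        show "11 < B" using B by simp
      next
        assume "m3 11 = 0"
        then have Ru: "u \<le> R" using m3(2) by (simp split: if_splits)
        have "below n k l (Suc P) \<le> r - 1" using bS R Ru by simp
        note inc = search_incr[OF r P l this par]
        let ?m = "exec [Sub 0 0 9, Add 3 3 14] m3"
        have m: "?m x = (if x = 0 then int (R - u) else if x = 3 then int (Suc P) else m3 x)" for x
          using Ru by (simp add: v3 m3 envD(1-6)[OF e3])
        have "env n k (\<lambda>e. k ^ e) ?m" using e3 unfolding env_def m by simp
        then have "J (R - u) (Suc P) l ?m"
          unfolding J_def m using v3 l inc R bS Ru par by simp
        then have "I ?m" unfolding I_def by blast
        moreover have "f ?m < f m1"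
        proof -
          have "Suc P mod k < k" using k by simp
          then have "k - 1 - Suc P mod k < k - 1 - P mod k" using inc(3) by linarith
          moreover have "f ?m = 1 + (n - l) * k + (k - 1 - Suc P mod k)"
            unfolding f_def m using v3 by (simp del: of_nat_Suc)
          ultimately show ?thesis using f1 by linarith
        qed
        moreover have "safe B [Sub 0 0 9, Add 3 3 14] m3" using B by simp
        ultimately show "wp B (Blk [Sub 0 0 9, Add 3 3 14]) 5 (\<lambda>m'. I m' \<and> f m' < f m1) m3"
          by (intro wp_mono[OF wp_Blk[where Q = "\<lambda>m'. m' = ?m"]]) auto
      next
        assume "m3 11 \<noteq> 0"
        then have Ru: "R < u" using m3(2) by (simp split: if_splits)
        let ?m4 = "m3(17 := if l < n then 1 else 0)"
        have m4: "exec [Less 17 4 1] m3 = ?m4" by (simp add: v3 envD(1-6)[OF e3])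
        have "wp B (Cond 17 (Blk [Mul 3 3 2, Add 4 4 14]) (Blk [])) (2 + 2) (\<lambda>m'. I m' \<and> f m' < f m1) ?m4"
        proof (rule wp_Cond)
          show "17 < B" using B by simp
        next
          assume "?m4 17 = 0"
          then have ln: "l = n" using l by (simp split: if_splits)
          have "env n k (\<lambda>e. k ^ e) ?m4" using e3 unfolding env_def by simp
          then have "J R P l ?m4"
            unfolding J_def using v3 l P R par bS Ru ln by simp
          then have "I ?m4" unfolding I_def by blast
          moreover have "f ?m4 < f m1" using f1 ln by (simp add: f_def)
          ultimately show "wp B (Blk []) 2 (\<lambda>m'. I m' \<and> f m' < f m1) ?m4"
            by (intro wp_mono[OF wp_Blk[where Q = "\<lambda>m'. m' = ?m4"]]) auto
        next
          assume "?m4 17 \<noteq> 0"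
          then have ln: "l < n" by (simp split: if_splits)
          let ?m = "exec [Mul 3 3 2, Add 4 4 14] ?m4"
          have m: "?m x = (if x = 4 then int (Suc l) else if x = 3 then int (P * k) else m3 x)" for x
            using ln v3 by (simp add: envD(1-6)[OF e3])
          have "env n k (\<lambda>e. k ^ e) ?m" using e3 unfolding env_def m by simp
          moreover have "P * k < k ^ Suc l" using P k by simp
          moreover have "R + below n k (Suc l) (P * k) = r - 1" using below_mult[OF ln] R by simp
          moreover have "r - 1 < below n k l (P * k div k + 1)" using bS R Ru k by simp
          ultimately have "J R (P * k) (Suc l) ?m"
            unfolding J_def m using v3 ln by simp
          then have "I ?m" unfolding I_def by blast
          \<comment> \<open>A new letter lowers the level term by \<open>k\<close> and restores at
            most \<open>k - 1\<close> sibling steps.\<close>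
          moreover have "f ?m < f m1"
          proof -
            have "f ?m = 1 + (n - Suc l) * k + (k - 1 - (P * k) mod k)"
              unfolding f_def m using v3 by (simp del: of_nat_Suc of_nat_mult)
            also have "\<dots> = 1 + (n - Suc l) * k + (k - 1)" by simp
            also have "\<dots> = (n - l) * k"
            proof -
              have "(n - l) * k = (n - Suc l) * k + k"
                using ln by (metis Suc_diff_Suc add.commute mult_Suc)
              then show ?thesis using k by simp
            qed
            also have "\<dots> < f m1" using f1 by simp
            finally show ?thesis .
          qed
          moreover have "safe B [Mul 3 3 2, Add 4 4 14] ?m4" using B by simp
          ultimately show "wp B (Blk [Mul 3 3 2, Add 4 4 14]) 2 (\<lambda>m'. I m' \<and> f m' < f m1) ?m4"
            by (intro wp_mono[OF wp_Blk[where Q = "\<lambda>m'. m' = ?m"]]) auto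
        qed
        then have "wp B (Seq (Blk [Less 17 4 1]) (Cond 17 (Blk [Mul 3 3 2, Add 4 4 14]) (Blk [])))
             (1 + (2 + 2)) (\<lambda>m'. I m' \<and> f m' < f m1) m3"
          using B m4 by (intro wp_Seq wp_mono[OF wp_Blk[where Q = "\<lambda>m'. m' = ?m4"]]) auto
        then show "wp B (Seq (Blk [Less 17 4 1]) (Cond 17 (Blk [Mul 3 3 2, Add 4 4 14]) (Blk []))) 5
             (\<lambda>m'. I m' \<and> f m' < f m1) m3" by simp
      qed
      then have "wp B ?c2 7 (\<lambda>m'. I m' \<and> f m' < f m1) m3" by simp
      then show ?thesis using s m3_def
        by (intro wp_Seq wp_mono[OF wp_Blk[where Q = "\<lambda>m'. m' = m3"]]) auto
    qed
    have v3': "m1 3 = int (word_val k p)" using v1(2) p(2) by simp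
    have "wp B (Seq count_prog (Seq (Blk ?c1) ?c2)) (?T + (3 + 7)) (\<lambda>m'. I m' \<and> f m' < f m1) m1"
      by (rule wp_Seq, rule wp_mono[OF wp_count_word[OF e1 B p(1) v3' v1(3) l n] order_refl],
          fold u_def, rule step)
    then show "wp B (Seq count_prog (Seq (Blk ?c1) ?c2)) (?T + (3 + 7))
        (\<lambda>m'. I m' \<and> f m' < f m1) (exec [] m1)" by simp
  qed
  moreover have "f m + 1 \<le> n * k + k + 1" using v k by (simp add: f_def)
  then have "(f m + 1) * (?T + (3 + 7) + length ([] :: instr list) + 2) \<le> (n * k + k + 1) * (?T + 12)"
    by (intro mult_mono) auto
  ultimately show ?thesis by (rule wp_mono)
qed

section \<open>Writing the letters to the output registers\<close>

lemma exec_append: "exec (c @ d) m = exec d (exec c m)"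
  by (induction c arbitrary: m) auto

lemma safe_append: "safe B (c @ d) m \<longleftrightarrow> safe B c m \<and> safe B d (exec c m)"
  by (induction c arbitrary: m) auto

text \<open>Because \<open>c <= h\<close>, no source register \<open>h + x\<close> is among those
  overwritten; the list starts at 1, so the base address in register 0 survives.\<close>

lemma fetch_correct:
  assumes "m 0 = int h" "c \<le> h" "h + c \<le> B"
  shows "safe B (fetch c) m \<and> (\<forall>x. exec (fetch c) m x = (if 1 \<le> x \<and> x < c then m (h + x) else m x))"
  using assms(2,3)
proof (induction c)
  case 0
  then show ?case by (simp add: fetch_def)
next
  case (Suc c)
  show ?case
  proof (cases "c = 0")
    case True
    then show ?thesis by (simp add: fetch_def)
  next
    case False
    let ?m = "exec (fetch c) m"
    have IH: "safe B (fetch c) m" "\<And>x. ?m x = (if 1 \<le> x \<and> x < c then m (h + x) else m x)"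
      using Suc by auto
    have f: "fetch (Suc c) = fetch c @ [Const c (int c), Add c c 0, Load c c]"
      using False by (simp add: fetch_def)
    have a: "nat (int c + int h) = c + h" by simp
    have h: "?m 0 = int h" "?m (c + h) = m (h + c)" using IH(2) assms(1) Suc.prems by (auto simp: add.commute)
    have "safe B [Const c (int c), Add c c 0, Load c c] ?m"
      using False Suc.prems h by (simp add: a)
    moreover have "exec [Const c (int c), Add c c 0, Load c c] ?m x =
        (if 1 \<le> x \<and> x < Suc c then m (h + x) else m x)" for x
      using False Suc.prems h IH(2)[of x] by (auto simp: a)
    ultimately show ?thesis unfolding f exec_append safe_append using IH(1) by blast
  qed
qed

lemma wp_decode:
  assumes B: "2 * n + 60 \<le> B" and w: "is_word k n w"
    and v: "m 2 = int k" "m 14 = 1" "m 16 = 21 + int n" "m 3 = int (word_val k w)" "m 5 = int n"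
  shows "wp B decode_prog ((n + 1) * 13) (\<lambda>m'. m' 16 = 21 + int n \<and>
    (\<forall>j<n. m' (21 + n + j) = int (w ! j) \<and> (20 \<le> j \<longrightarrow> m' j = int (w ! j)))) m"
proof -
  have lw: "length w = n" using w by (simp add: is_word_def)
  let ?b = "[Sub 5 5 14, Mod 11 3 2, Add 11 11 14, Div 3 3 2, Add 12 16 5, Store 12 11,
                Const 12 20, Less 12 5 12]"
  define I where "I i m1 \<longleftrightarrow> i \<le> n \<and> m1 5 = int i \<and> m1 3 = int (word_val k (take i w)) \<and>
     m1 2 = int k \<and> m1 14 = 1 \<and> m1 16 = 21 + int n \<and>
     (\<forall>j. i \<le> j \<longrightarrow> j < n \<longrightarrow> m1 (21 + n + j) = int (w ! j) \<and> (20 \<le> j \<longrightarrow> m1 j = int (w ! j)))"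
    for i m1
  define f where "f m1 = nat (m1 5)" for m1 :: "nat \<Rightarrow> int"
  have "wp B decode_prog ((f m + 1) * (8 + (1 + 2) + length ([] :: instr list) + 2))
    (\<lambda>m'. m' 16 = 21 + int n \<and>
    (\<forall>j<n. m' (21 + n + j) = int (w ! j) \<and> (20 \<le> j \<longrightarrow> m' j = int (w ! j)))) m"
    unfolding decode_prog_def
  proof (rule wp_While[where I = "\<lambda>m. \<exists>i. I i m"])
    show "5 < B" using B by simp
    show "\<exists>i. I i m" using v lw by (intro exI[of _ n]) (simp add: I_def)
  next
    fix m1 show "safe B [] m1" by simp
  next
    fix m1 assume "\<exists>i. I i m1" "exec [] m1 5 = 0"
    then have "I 0 m1" by (auto simp: I_def)
    then show "exec [] m1 16 = 21 + int n \<and>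
      (\<forall>j<n. exec [] m1 (21 + n + j) = int (w ! j) \<and> (20 \<le> j \<longrightarrow> exec [] m1 j = int (w ! j)))"
      by (simp add: I_def)
  next
    fix m1 assume "\<exists>i. I i m1" "exec [] m1 5 \<noteq> 0"
    then obtain i' where "I i' m1" "i' \<noteq> 0" by (auto simp: I_def)
    then obtain i where i: "I (Suc i) m1" by (cases i') auto
    then have n: "i < n" by (simp add: I_def)
    define A d where "A = word_val k (take i w)" and "d = w ! i"
    have "d \<in> {1..k}" using w n lw nth_mem[of i w] unfolding is_word_def d_def by blast
    then have d: "1 \<le> d" "d \<le> k" by simp_all
    have V: "word_val k (take (Suc i) w) = A * k + (d - 1)"
      using n lw by (simp add: take_Suc_conv_app_nth A_def d_def)
    define C where "C = A * k + (d - 1)"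
    have "d - 1 < k" using d by linarith
    then have C: "C div k = A" "C mod k = d - 1"
      unfolding C_def by (rule div_digit) (simp only: mod_mult_self3 mod_less \<open>d - 1 < k\<close>)
    have v1: "m1 5 = 1 + int i" "m1 3 = int C" "m1 2 = int k" "m1 14 = 1" "m1 16 = 21 + int n"
      using i by (auto simp: I_def V C_def)
    have C': "int C mod int k = int (d - 1)" "int C div int k = int A" "int (d - 1) + 1 = int d"
      using C d by (simp_all flip: of_nat_mod of_nat_div)
    define h where "h = 21 + n + i"
    have a: "nat (21 + int n + int i) = h" "h < B" "21 \<le> h" using B n by (auto simp: h_def)
    define m2 where "m2 = exec ?b m1"
    have s: "safe B ?b m1" using B a(2) by (simp add: v1 a(1) C')
    have m2: "m2 x = (if x = 12 then (if i < 20 then 1 else 0) else if x = h then int d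
        else if x = 3 then int A else if x = 11 then int d else if x = 5 then int i else m1 x)" for x
      unfolding m2_def using a(3) d by (simp add: v1 a(1) C')
    have m2': "m2 5 = int i" "m2 11 = int d" "m2 12 = (if i < 20 then 1 else 0)"
      unfolding m2 using a(3) by auto
    have I2: "m2 5 = int i" "m2 3 = int A" "m2 2 = int k" "m2 14 = 1" "m2 16 = 21 + int n"
      unfolding m2 using a(3) v1 by auto
    have J2: "m2 (21 + n + j) = int (w ! j)" if "i \<le> j" "j < n" for j
      using that i unfolding m2 by (cases "i = j") (auto simp: h_def I_def d_def)
    have K2: "m2 j = int (w ! j)" if "Suc i \<le> j" "j < n" "20 \<le> j" for j
      using that i unfolding m2 by (auto simp: h_def I_def)
    have "wp B (Cond 12 (Blk []) (Blk [Store 5 11])) (1 + 2) (\<lambda>m'. (\<exists>i. I i m') \<and> f m' < f m1) m2"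
    proof (rule wp_Cond)
      show "12 < B" using B by simp
    next
      assume "m2 12 \<noteq> 0"
      then have "i < 20" unfolding m2' by (simp split: if_splits)
      have "I i m2" unfolding I_def using I2 J2 K2 n \<open>i < 20\<close> by (auto simp: A_def)
      moreover have "f m2 < f m1" unfolding f_def I2 v1 by simp
      ultimately show "wp B (Blk []) 1 (\<lambda>m'. (\<exists>i. I i m') \<and> f m' < f m1) m2"
        by (intro wp_mono[OF wp_Blk[where Q = "\<lambda>m'. m' = m2"]]) auto
    next
      assume "m2 12 = 0"
      then have i20: "20 \<le> i" unfolding m2' by (simp split: if_splits)
      let ?m = "m2(i := int d)"
      have m: "exec [Store 5 11] m2 = ?m" by (simp add: m2')
      \<comment> \<open>The written register \<open>i\<close> lies between the working registers, as
        \<open>20 <= i\<close>, and the stored letters, as \<open>i < n\<close>.\<close>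
      have "I i ?m" unfolding I_def using I2 J2 K2 n i20 by (auto simp: A_def d_def)
      moreover have "f ?m < f m1" unfolding f_def using I2 i20 v1 by simp
      moreover have "safe B [Store 5 11] m2" using B n by (simp add: m2')
      ultimately show "wp B (Blk [Store 5 11]) 1 (\<lambda>m'. (\<exists>i. I i m') \<and> f m' < f m1) m2"
        using m by (intro wp_mono[OF wp_Blk[where Q = "\<lambda>m'. m' = ?m"]]) auto
    qed
    then show "wp B (Seq (Blk ?b) (Cond 12 (Blk []) (Blk [Store 5 11]))) (8 + (1 + 2))
        (\<lambda>m'. (\<exists>i. I i m') \<and> f m' < f m1) (exec [] m1)"
      using s m2_def by (intro wp_Seq wp_mono[OF wp_Blk[where Q = "\<lambda>m'. m' = m2"]]) auto
  qed
  then show ?thesis by (rule wp_mono) (simp_all add: f_def v)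
qed

lemma wp_unrank:
  assumes n: "1 \<le> n" and k: "2 \<le> k" and r: "1 \<le> r" "r \<le> card (unb_words n k)"
    and B: "2 * n + 60 \<le> B"
    and v: "m 0 = int r" "m 1 = int n" "m 2 = int k"
  shows "wp B unrank_prog (600 * (n ^ 3 * k))
    (\<lambda>m'. \<exists>w. has_rank n k r w \<and> (\<forall>j<n. m' j = int (w ! j))) m"
proof -
  let ?b0 = "[Const 14 1, Sub 0 0 14, Const 3 0, Const 4 0, Const 15 20, Add 16 15 1,
        Add 16 16 14, Const 17 1, Const 5 0, Const 9 1]"
  let ?b4 = "[Const 11 0, Add 5 1 11]"
  let ?b6 = "[Const 11 0, Add 0 16 11] @ fetch 20 @ [Load 0 0]"
  let ?t2 = "(n + 2) * 8"
  let ?t3 = "(n * k + k + 1) * ((n + 1) * (25 * (n + 1) + 20) + 12)"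
  let ?t5 = "(n + 1) * 13"
  let ?Q = "\<lambda>m'. \<exists>w. has_rank n k r w \<and> (\<forall>j<n. m' j = int (w ! j))"
  have r': "r - 1 < card (unb_words n k)" using r by simp
  have last: "wp B (Blk ?b6) 60 ?Q m5"
    if hr: "has_rank n k r w" and m5: "m5 16 = 21 + int n \<and>
      (\<forall>j<n. m5 (21 + n + j) = int (w ! j) \<and> (20 \<le> j \<longrightarrow> m5 j = int (w ! j)))" for m5 w
  proof -
    define h where "h = 21 + n"
    let ?m6 = "exec [Const 11 0, Add 0 16 11] m5"
    let ?m7 = "exec (fetch 20) ?m6"
    have m6: "?m6 0 = int h" "\<And>x. x \<noteq> 0 \<Longrightarrow> x \<noteq> 11 \<Longrightarrow> ?m6 x = m5 x"
      using m5 by (auto simp: h_def)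
    have "20 \<le> h" "h + 20 \<le> B" using B by (auto simp: h_def)
    from fetch_correct[of ?m6 h 20 B, OF m6(1) this]
    have m7: "safe B (fetch 20) ?m6"
      "\<And>x. ?m7 x = (if 1 \<le> x \<and> x < 20 then ?m6 (h + x) else ?m6 x)" by blast+
    have 0: "?m7 0 = int h" using m7(2)[of 0] m6(1) by simp
    have s: "safe B ?b6 m5"
      unfolding safe_append using m7(1) 0 B by (simp add: h_def)
    have ex: "exec ?b6 m5 = ?m7(0 := ?m7 h)"
      unfolding exec_append using 0 by simp
    have "exec ?b6 m5 j = int (w ! j)" if "j < n" for j
    proof -
      have h: "?m7 h = ?m6 h" using m7(2)[of h] by (simp add: h_def)
      consider "j = 0" | "1 \<le> j" "j < 20" | "20 \<le> j" by linarith
      then show ?thesis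
      proof cases
        case 1
        have "?m6 h = m5 h" by (rule m6(2)) (simp_all add: h_def)
        then show ?thesis unfolding ex using 1 m5 that h by (auto simp: h_def)
      next
        case 2
        have "?m6 (h + j) = m5 (h + j)" by (rule m6(2)) (simp_all add: h_def)
        then show ?thesis unfolding ex using 2 m7(2)[of j] m5 that by (simp add: h_def)
      next
        case 3
        have "?m6 j = m5 j" using 3 by (intro m6(2)) auto
        then show ?thesis unfolding ex using 3 m7(2)[of j] m5 that by simp
      qed
    qed
    then have "?Q (exec ?b6 m5)" using hr by blast
    \<comment> \<open>2 + 3 * 19 + 1, as \<open>fetch 20\<close> treats registers 1 to 19.\<close>
    moreover have "length ?b6 \<le> 60" by (simp add: fetch_def upt_conv_Cons)
    ultimately show ?thesis
      using s by (intro wp_mono[OF wp_Blk[where Q = "\<lambda>m'. m' = exec ?b6 m5"]]) auto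
  qed
  have dec: "wp B (Seq (Blk ?b4) (Seq decode_prog (Blk ?b6))) (2 + (?t5 + 60)) ?Q m3"
    if e: "env n k (\<lambda>e. k ^ e) m3" and hr: "has_rank n k r w" and P: "m3 3 = int (word_val k w)" for m3 w
  proof -
    have w: "is_word k n w" using hr by (simp add: has_rank_def unb_words_def)
    let ?m4 = "exec ?b4 m3"
    have v4: "?m4 2 = int k" "?m4 14 = 1" "?m4 16 = 21 + int n" "?m4 3 = int (word_val k w)" "?m4 5 = int n"
      using envD[OF e] P by auto
    have "wp B (Seq decode_prog (Blk ?b6)) (?t5 + 60) ?Q ?m4"
      by (rule wp_Seq, rule wp_mono[OF wp_decode[OF B w v4] order_refl], rule last[OF hr])
    then show ?thesis using B
      by (intro wp_Seq[where ?t1.0 = 2] wp_mono[OF wp_Blk[where Q = "\<lambda>m'. m' = ?m4"]]) auto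
  qed
  have srch: "wp B (Seq search_prog (Seq (Blk ?b4) (Seq decode_prog (Blk ?b6))))
      (?t3 + (2 + (?t5 + 60))) ?Q m2"
    if e: "env n k (\<lambda>e. k ^ e) m2" and v2: "m2 0 = int (r - 1)" "m2 3 = 0" "m2 4 = 0" "m2 17 = 1" for m2
    by (rule wp_Seq, rule wp_mono[OF wp_search[OF e B v2 r' n k] order_refl], elim conjE exE, rule dec)
  let ?m1 = "exec ?b0 m"
  have v1: "?m1 1 = int n" "?m1 2 = int k" "?m1 14 = 1" "?m1 15 = 20" "?m1 16 = 21 + int n"
     "?m1 5 = 0" "?m1 9 = 1" "?m1 0 = int (r - 1)" "?m1 3 = 0" "?m1 4 = 0" "?m1 17 = 1"
    using v r(1) by auto
  have "wp B (Seq power_prog (Seq search_prog (Seq (Blk ?b4) (Seq decode_prog (Blk ?b6)))))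
      (?t2 + (?t3 + (2 + (?t5 + 60)))) ?Q ?m1"
  proof (rule wp_Seq, rule wp_mono[OF wp_power[OF B v1(1-7)] order_refl])
    fix m2 assume "env n k (\<lambda>e. k ^ e) m2 \<and> (\<forall>x\<in>{0, 3, 4, 17}. m2 x = ?m1 x)"
    then show "wp B (Seq search_prog (Seq (Blk ?b4) (Seq decode_prog (Blk ?b6))))
      (?t3 + (2 + (?t5 + 60))) ?Q m2"
      using v1(8-11) by (intro srch) (simp_all del: exec.simps)
  qed
  then have "wp B unrank_prog (10 + (?t2 + (?t3 + (2 + (?t5 + 60))))) ?Q m"
    unfolding unrank_prog_def using B
    by (intro wp_Seq[where ?t1.0 = 10] wp_mono[OF wp_Blk[where Q = "\<lambda>m'. m' = ?m1"]]) auto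
  \<comment> \<open>The search contributes 3 * 152 = 456 and the linear rest at most 122, together
    578.\<close>
  moreover have "10 + (?t2 + (?t3 + (2 + (?t5 + 60)))) \<le> 600 * (n ^ 3 * k)"
  proof -
    have 1: "n * k + k + 1 \<le> 3 * (n * k)"
    proof -
      have "1 * k \<le> n * k" "1 * 1 \<le> n * k" using n k by (intro mult_mono; simp)+
      then show ?thesis by linarith
    qed
    have 2: "(n + 1) * (25 * (n + 1) + 20) + 12 \<le> 152 * (n * n)"
    proof -
      have "(n + 1) * (25 * (n + 1) + 20) \<le> (2 * n) * (70 * n)" using n by (intro mult_mono) auto
      moreover have "1 * 1 \<le> n * n" using n by (intro mult_mono) auto
      ultimately show ?thesis by linarith
    qed
    have 3: "?t3 \<le> 456 * (n ^ 3 * k)"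
    proof -
      have "?t3 \<le> (3 * (n * k)) * (152 * (n * n))" using 1 2 by (rule mult_mono) auto
      then show ?thesis by (simp add: power3_eq_cube ac_simps)
    qed
    have 4: "n \<le> n ^ 3 * k"
    proof -
      have "n * 1 * 1 \<le> n * (n * n) * k" using n k by (intro mult_mono) auto
      then show ?thesis by (simp add: power3_eq_cube ac_simps)
    qed
    have "10 + (?t2 + (?t3 + (2 + (?t5 + 60)))) \<le> 122 * n + ?t3" using n by simp
    then show ?thesis using 3 4 by linarith
  qed
  ultimately show ?thesis by (rule wp_mono)
qed

theorem theorem12:
  shows "\<exists>(P :: instr list) (C :: real). \<forall>n k r.
     1 \<le> n \<longrightarrow> 2 \<le> k \<longrightarrow> 1 \<le> r \<longrightarrow> r \<le> card (unb_words n k) \<longrightarrow>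
     (\<exists>t s. runs P (init_state r n k) t s \<and>
        real t \<le> C * real n ^ 4 * real k * log 2 (real k) \<and>
        real (space_used s) \<le> C * real n \<and>
        (\<exists>w. has_rank n k r w \<and> output_word n s = map int w))"
proof (intro exI[of _ "compile 0 unrank_prog"] exI[of _ "600 :: real"] allI impI)
  fix n k r :: nat
  assume n: "1 \<le> n" and k: "2 \<le> k" and r: "1 \<le> r" "r \<le> card (unb_words n k)"
  define m :: "nat \<Rightarrow> int" where "m = (\<lambda>_. 0)(0 := int r, 1 := int n, 2 := int k)"
  have i: "init_state r n k = (0, m, {0, 1, 2})" by (simp add: init_state_def m_def)
  \<comment> \<open>The count table ends at \<open>21 + 2 * n\<close>, and \<open>fetch 20\<close>
    reads up to \<open>40 + n\<close>; both stay below this bound.\<close>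
  let ?B = "2 * n + 60"
  have "wp ?B unrank_prog (600 * (n ^ 3 * k))
    (\<lambda>m'. \<exists>w. has_rank n k r w \<and> (\<forall>j<n. m' j = int (w ! j))) m"
    by (rule wp_unrank[OF n k r]) (simp_all add: m_def)
  from wp_runs[OF this, of "{0, 1, 2}"] obtain t m' A' w where
    t: "t \<le> 600 * (n ^ 3 * k)" and w: "has_rank n k r w" "\<And>j. j < n \<Longrightarrow> m' j = int (w ! j)"
    and A': "A' \<subseteq> {0, 1, 2} \<union> {..<?B}"
    and run: "runs (compile 0 unrank_prog) (0, m, {0, 1, 2}) t (length (compile 0 unrank_prog), m', A')"
    by blast
  let ?s = "(length (compile 0 unrank_prog), m', A')"
  have "real t \<le> real (600 * (n ^ 3 * k))" using t by (simp only: of_nat_le_iff)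
  also have "\<dots> = 600 * real n ^ 3 * real k * 1" by simp
  \<comment> \<open>One factor \<open>n\<close> and the logarithm are slack; the latter is at least
    1 because \<open>k >= 2\<close>.\<close>
  also have "\<dots> \<le> 600 * real n ^ 4 * real k * log 2 (real k)"
  proof (intro mult_mono)
    show "real n ^ 3 \<le> real n ^ 4" using n by (intro power_increasing) auto
    show "1 \<le> log 2 (real k)" using k by (subst le_log_iff) auto
  qed auto
  finally have time: "real t \<le> 600 * real n ^ 4 * real k * log 2 (real k)" .
  have "A' \<subseteq> {..<?B}" using A' by auto
  then have "card A' \<le> card {..<?B}" by (intro card_mono) auto
  then have "card A' \<le> 600 * n" using n by simp
  then have "real (card A') \<le> real (600 * n)" by (simp only: of_nat_le_iff)
  then have space: "real (space_used ?s) \<le> 600 * real n" by (simp add: space_used_def)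
  have "length w = n" using w(1) by (simp add: has_rank_def unb_words_def is_word_def)
  then have "output_word n ?s = map int w"
    by (intro nth_equalityI) (simp_all add: output_word_def w(2))
  then show "\<exists>t s. runs (compile 0 unrank_prog) (init_state r n k) t s \<and>
        real t \<le> 600 * real n ^ 4 * real k * log 2 (real k) \<and>
        real (space_used s) \<le> 600 * real n \<and>
        (\<exists>w. has_rank n k r w \<and> output_word n s = map int w)"
    unfolding i using run time space w(1) by blast
qed

end
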